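(* Let $\mathcal{B}=([n],\mathcal{E})$ be a chordal building set, and let $\Pi_{\mathcal{B}}=\{\pi_h \mid h\in \mathrm{AO}_{\mathcal{B}}\}\subseteq S_n$ be the set of permutations encoding the acyclic orientations of $\mathcal{B}$ (see context). Then Algorithm J with input $\Pi_{\mathcal{B}}$ and initial permutation $\mathrm{id}_n$ generates a sequence of permutations $\pi_{h_1},\pi_{h_2},\ldots$ with $h_1,h_2,\ldots\in \mathrm{AO}_{\mathcal{B}}$ such that $h_1,h_2,\ldots$ is a Hamilton path in the flip graph on acyclic orientations of $\mathcal{B}$, or equivalently (via the identification of $h$ with the vertex $\delta_{\mathcal{B},h}$), a Hamilton path on the skeleton of the chordal nestohedron $Z(\mathcal{B})$.
   Context: Hypergraphs. $[n]=\{1,\ldots,n\}$. A hypergraph $\mathcal{B}=([n],\mathcal{E})$ has $\mathcal{E}\subseteq 2^{[n]}$ with all hyperedges nonempty. For $i\le n$, $\mathcal{B}_i$ is the hypergraph on $[i]$ whose hyperedges are those $A\in\mathcal{E}$ with $A\subseteq[i]$. Chordal building sets. $\mathcal{B}=([n],\mathcal{E})$ is a building set if (i) $\{v\}\in\mathcal{E}$ for all $v\in[n]$ and (ii) $A,B\in\mathcal{E}$ with $A\cap B\ne\emptyset$ implies $A\cup B\in\mathcal{E}$. A building set is chordal if for any $A=\{i_1<i_2<\cdots<i_r\}\in\mathcal{E}$ and $s\in[r]$ we have $\{i_1<i_2<\cdots<i_s\}\in\mathcal{E}$. Orientations. An orientation of $\mathcal{B}$ is a map $h:\mathcal{E}\to[n]$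 with $h(A)\in A$ for all $A\in\mathcal{E}$. It is acyclic if the digraph on $[n]$ with an arc $i\to j$ for all distinct $i,j$ such that $i,j\in A$ and $j=h(A)$ for some $A\in\mathcal{E}$ is acyclic. $\mathrm{AO}_{\mathcal{B}}$ is the set of acyclic orientations. For $h\in\mathrm{AO}_{\mathcal{B}}$, $P_{\mathcal{B},h}$ is the poset on $[n]$ given by the transitive closure of: $i\prec j$ if $i\ne j$ and there is $A\in\mathcal{E}$ with $i,j\in A$ and $j=h(A)$. Flip graph. A pair flip of a pair $(i,j)$ of distinct vertices maps an orientation $h$ to the orientation $h'$ with $h'(A)=i$ if $h(A)=j$ and $i\in A$, and $h'(A)=h(A)$ otherwise, where $h'\neq h$ is required. The flip graph on $\mathrm{AO}_{\mathcal{B}}$ joins two acyclic orientations by an edge iff they differ in a pair flip. Nestohedron. $Z(\mathcal{B})=\sum_{A\in\mathcal{E}}\Delta_A$ (Minkowski sum), where $\Delta_A=\mathrm{conv}\{e_i\mid i\in A\}\subseteq\mathbb{R}^n$; for a chordal building set it is called a chordal nestohedron. Its vertices are the in-degree sequences $\delta_{\mathcal{B},h}=(d^-(1),\ldots,d^-(n))$, $d^-(i)=|\{A\in\mathcal{E}\mid h(A)=i\}|$, for $h\in \mathrm{AO}_{\mathcal{B}}$, and it is known that $h\mapsto\delta_{\mathcal{B},h}$ is an isomorphism from the flip graph on $\mathrm{AO}_{\mathcal{B}}$ to the skeleton of $Z(\mathcal{B})$. Permutations. $S_n$ is the set of permutations of $[n]$ written as words $a_1\cdots a_n$, $\mathrm{id}_n=12\cdots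 n$, $\varepsilon$ is the empty permutation. For $\pi\in S_{n-1}$ and $1\le i\le n$, $c_i(\pi)\in S_n$ is obtained from $\pi$ by inserting the value $n$ at position $i$. Encoding. For a chordal building set $\mathcal{B}$ and $h\in\mathrm{AO}_{\mathcal{B}}$ let $h_{n-1}$ be the restriction of $h$ to $\mathcal{B}_{n-1}$. Define $\pi_h\in S_n$ by $\pi_h:=\varepsilon$ if $n=0$, and for $n\ge1$: (i) if $n$ is maximal in $P_{\mathcal{B},h}$, then $\pi_h:=c_n(\pi_{h_{n-1}})$; (ii) else if $n$ is minimal in $P_{\mathcal{B},h}$, then $\pi_h:=c_1(\pi_{h_{n-1}})$; (iii) otherwise $\pi_h:=c_i(\pi_{h_{n-1}})$, where $i$ is the position in $\pi_{h_{n-1}}$ of the (unique) vertex that covers $n$ in $P_{\mathcal{B},h}$. The map $h\mapsto\pi_h$ is injective. Jumps. Given $\pi=a_1\cdots a_n$ with a substring $a_i\cdots a_{i+d}$, $d>0$, $a_i>a_{i+1},\ldots,a_{i+d}$, a right jump of the value $a_i$ by $d$ steps replaces this substring by $a_{i+1}\cdots a_{i+d}a_i$. Given a substring $a_{i-d}\cdots a_i$, $d>0$, $a_i>a_{i-d},\ldots,a_{i-1}$, a left jump of $a_i$ by $d$ steps replaces it by $a_ia_{i-d}\cdots a_{i-1}$. A jump is minimal with respect to $L_n\subseteq S_n$ if every jump of the same value in the same direction by fewer steps creates a permutation not in $L_n$. Algorithm J (input $L_n\subseteq S_n$, initial permutation $\pi_0\in L_n$). J1: Visit $\pi_0$. J2: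 Generate an unvisited permutation from $L_n$ by performing a minimal jump of the largest possible value in the most recently visited permutation. If no such jump exists, or the jump direction is ambiguous, terminate. Otherwise visit this permutation and repeat J2. *)

theory Defs
  imports "HOL-Analysis.Analysis" "HOL-Library.While_Combinator"
begin

text \<open>A hypergraph on the vertex set \<open>{1..n}\<close> is represented by its set of hyperedges.\<close>

definition hypergraph :: "nat \<Rightarrow> nat set set \<Rightarrow> bool" where
  "hypergraph n E \<longleftrightarrow> (\<forall>A\<in>E. A \<subseteq> {1..n} \<and> A \<noteq> {})"

definition building_set :: "nat \<Rightarrow> nat set set \<Rightarrow> bool" where
  "building_set n E \<longleftrightarrow> hypergraph n E \<and> (\<forall>v\<in>{1..n}. {v} \<in> E) \<and>
     (\<forall>A\<in>E. \<forall>B\<in>E. A \<inter> B \<noteq> {} \<longrightarrow> A \<union> B \<in> E)"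

definition chordal_building_set :: "nat \<Rightarrow> nat set set \<Rightarrow> bool" where
  "chordal_building_set n E \<longleftrightarrow> building_set n E \<and>
     (\<forall>A\<in>E. \<forall>s\<in>{1..card A}. set (take s (sorted_list_of_set A)) \<in> E)"

definition restrict_edges :: "nat set set \<Rightarrow> nat \<Rightarrow> nat set set" where
  "restrict_edges E i = {A \<in> E. A \<subseteq> {1..i}}"

definition arcs :: "nat set set \<Rightarrow> (nat set \<Rightarrow> nat) \<Rightarrow> (nat \<times> nat) set" where
  "arcs E h = {(i, j). i \<noteq> j \<and> (\<exists>A\<in>E. i \<in> A \<and> j \<in> A \<and> j = h A)}"

text \<open>Orientations are extensional functions, so that two of them are equal as soon as they
  agree on all hyperedges.\<close>

definition acyclic_orientations :: "nat set set \<Rightarrow> (nat set \<Rightarrow> nat) set" where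
  "acyclic_orientations E = {h \<in> (\<Pi>\<^sub>E A\<in>E. A). acyclic (arcs E h)}"

text \<open>The strict order of the poset: \<open>(i, j) \<in> poset E h\<close> means that \<open>i\<close> lies below \<open>j\<close>.\<close>

definition poset :: "nat set set \<Rightarrow> (nat set \<Rightarrow> nat) \<Rightarrow> (nat \<times> nat) set" where
  "poset E h = (arcs E h)\<^sup>+"

definition covers :: "(nat \<times> nat) set \<Rightarrow> nat \<Rightarrow> nat \<Rightarrow> bool" where
  "covers P j i \<longleftrightarrow> (i, j) \<in> P \<and> \<not> (\<exists>k. (i, k) \<in> P \<and> (k, j) \<in> P)"

type_synonym 'v ugraph = "'v set \<times> 'v set set"

definition hamilton_path :: "'v ugraph \<Rightarrow> 'v list \<Rightarrow> bool" where
  "hamilton_path G vs \<longleftrightarrow> distinct vs \<and> set vs = fst G \<and>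
     (\<forall>k. Suc k < length vs \<longrightarrow> {vs ! k, vs ! Suc k} \<in> snd G)"

definition pair_flip ::
  "nat set set \<Rightarrow> nat \<Rightarrow> nat \<Rightarrow> (nat set \<Rightarrow> nat) \<Rightarrow> nat set \<Rightarrow> nat" where
  "pair_flip E i j h = (\<lambda>A\<in>E. if h A = j \<and> i \<in> A then i else h A)"

definition flip_graph :: "nat \<Rightarrow> nat set set \<Rightarrow> (nat set \<Rightarrow> nat) ugraph" where
  "flip_graph n E = (acyclic_orientations E,
     {{h, h'} | h h'. h \<in> acyclic_orientations E \<and> h' \<in> acyclic_orientations E \<and> h' \<noteq> h \<and>
        (\<exists>i\<in>{1..n}. \<exists>j\<in>{1..n}. i \<noteq> j \<and> h' = pair_flip E i j h)})"

text \<open>The coordinates of Euclidean space are indexed by a finite type; a bijection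
  \<open>lab\<close> from this type to \<open>{1..n}\<close> says which coordinate belongs to which vertex.\<close>

definition edge_simplex :: "('d::finite \<Rightarrow> nat) \<Rightarrow> nat set \<Rightarrow> (real ^ 'd) set" where
  "edge_simplex lab A = convex hull {axis k 1 | k. lab k \<in> A}"

text \<open>The sum of sets is the Minkowski sum.\<close>

definition nestohedron :: "('d::finite \<Rightarrow> nat) \<Rightarrow> nat set set \<Rightarrow> (real ^ 'd) set" where
  "nestohedron lab E = (\<Sum>A\<in>E. edge_simplex lab A)"

definition indegrees ::
  "('d::finite \<Rightarrow> nat) \<Rightarrow> nat set set \<Rightarrow> (nat set \<Rightarrow> nat) \<Rightarrow> real ^ 'd" where
  "indegrees lab E h = (\<chi> k. real (card {A \<in> E. h A = lab k}))"

definition skeleton :: "'a::euclidean_space set \<Rightarrow> 'a ugraph" where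
  "skeleton P = ({v. v extreme_point_of P}, {{u, v} | u v. closed_segment u v edge_of P})"

text \<open>Permutations are words; positions in a word are counted from 1.\<close>

definition insert_at :: "nat \<Rightarrow> nat \<Rightarrow> nat list \<Rightarrow> nat list" where
  "insert_at i m p = take (i - 1) p @ m # drop (i - 1) p"

definition position :: "nat list \<Rightarrow> nat \<Rightarrow> nat" where
  "position p x = Suc (length (takeWhile (\<lambda>y. y \<noteq> x) p))"

fun perm_of :: "nat \<Rightarrow> nat set set \<Rightarrow> (nat set \<Rightarrow> nat) \<Rightarrow> nat list" where
  "perm_of 0 E h = []"
| "perm_of (Suc m) E h =
     (let n = Suc m;
          P = poset E h;
          p = perm_of m (restrict_edges E m) (restrict h (restrict_edges E m))
      in if \<not> (\<exists>j. (n, j) \<in> P) then insert_at n n p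
         else if \<not> (\<exists>i. (i, n) \<in> P) then insert_at 1 n p
         else insert_at (position p (THE j. covers P j n)) n p)"

datatype direction = Leftward | Rightward

fun jump :: "direction \<Rightarrow> nat \<Rightarrow> nat \<Rightarrow> nat list \<Rightarrow> nat list \<Rightarrow> bool" where
  "jump Rightward a d p q \<longleftrightarrow> d > 0 \<and>
     (\<exists>xs ys zs. length ys = d \<and> (\<forall>y\<in>set ys. y < a) \<and>
        p = xs @ a # ys @ zs \<and> q = xs @ ys @ a # zs)"
| "jump Leftward a d p q \<longleftrightarrow> d > 0 \<and>
     (\<exists>xs ys zs. length ys = d \<and> (\<forall>y\<in>set ys. y < a) \<and>
        p = xs @ ys @ a # zs \<and> q = xs @ a # ys @ zs)"

definition minimal_jump ::
  "nat list set \<Rightarrow> direction \<Rightarrow> nat \<Rightarrow> nat list \<Rightarrow> nat list \<Rightarrow> bool" where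
  "minimal_jump L dir a p q \<longleftrightarrow>
     (\<exists>d. jump dir a d p q \<and> (\<forall>d'<d. \<forall>q'. jump dir a d' p q' \<longrightarrow> q' \<notin> L))"

text \<open>In the following, \<open>ps\<close> is the list of the permutations visited so far; its last
  entry is the most recent one.\<close>

definition jump_to_new ::
  "nat list set \<Rightarrow> nat list list \<Rightarrow> direction \<Rightarrow> nat \<Rightarrow> nat list \<Rightarrow> bool" where
  "jump_to_new L ps dir a q \<longleftrightarrow> minimal_jump L dir a (last ps) q \<and> q \<in> L \<and> q \<notin> set ps"

text \<open>The direction counts as ambiguous if the largest value that can jump to an unvisited element
  of \<open>L\<close> can do so by minimal jumps in both directions.\<close>

definition J_step :: "nat list set \<Rightarrow> nat list list \<Rightarrow> nat list \<Rightarrow> bool" where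
  "J_step L ps q \<longleftrightarrow> (\<exists>dir a. jump_to_new L ps dir a q \<and>
     (\<forall>dir' a' q'. jump_to_new L ps dir' a' q' \<longrightarrow> a' \<le> a \<and> (a' = a \<longrightarrow> dir' = dir)))"

text \<open>The result is the list of all visited permutations in the order of their visits at the
  time of termination (\<open>None\<close> would mean non-termination).\<close>

definition algorithm_J :: "nat list set \<Rightarrow> nat list \<Rightarrow> nat list list option" where
  "algorithm_J L p\<^sub>0 =
     while_option (\<lambda>ps. \<exists>q. J_step L ps q) (\<lambda>ps. ps @ [THE q. J_step L ps q]) [p\<^sub>0]"

end

theory Submission
  imports Defs
begin

text \<open>
  Write \<open>N\<close> for the last vertex. Chordality makes \<open>A - {N}\<close> a hyperedge for every hyperedge \<open>A \<noteq> {N}\<close>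
  containing \<open>N\<close>, and acyclicity leaves only \<open>N\<close> and the head of \<open>A - {N}\<close> as possible heads of \<open>A\<close>.
  Closure under unions makes the heads of all these \<open>A - {N}\<close> a chain, so the orientations extending a given
  one correspond to the places of \<open>N\<close> relative to this chain. As \<open>\<pi>\<^sub>h\<close> is a linear extension of the poset of
  \<open>h\<close>, every \<open>h\<close> is recovered by letting each hyperedge point to its last letter in \<open>\<pi>\<^sub>h\<close>. Hence the
  words of one fibre arise from a word on the smaller vertex set by inserting \<open>N\<close> at certain places, which
  include the end and, unless \<open>{N}\<close> is the only hyperedge containing \<open>N\<close>, the front. Algorithm J therefore
  sweeps \<open>N\<close> alternately from right to left and from left to right through the fibres, and in between, with \<open>N\<close> at an
  end of the word, acts as on the smaller vertex set. Neighbouring places in a fibre are separated by exactly one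
  head \<open>s\<close>, which makes the step a flip of the pair \<open>(N, s)\<close>; flips on the smaller vertex set stay flips.

  For the nestohedron, vertex weights that increase along the arcs of an orientation show that its indegree vector
  is a vertex, exposing functionals of vertices give back acyclic orientations, and for a flip of \<open>(i, j)\<close> one
  finds weights with the only tie \<open>i\<close>, \<open>j\<close>, whose maximal face is the segment between the two vertices.
\<close>

section \<open>Algorithm J and insertion of the largest value\<close>

text \<open>\<open>i\<close> counts the letters in front of the inserted one, so the slots run from
  0 to the length; \<open>insert_at (Suc i)\<close> is the same operation with positions counted
  from 1.\<close>

definition ins :: "nat \<Rightarrow> 'a \<Rightarrow> 'a list \<Rightarrow> 'a list" where
  "ins i x p = take i p @ x # drop i p"

lemma set_ins [simp]: "set (ins i x p) = insert x (set p)"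
  by (metis (no_types) Un_insert_right append_take_drop_id ins_def list.simps(15) set_append)

lemma length_ins [simp]: "length (ins i x p) = Suc (length p)"
  by (simp add: ins_def)

lemma distinct_ins [simp]: "distinct (ins i x p) \<longleftrightarrow> x \<notin> set p \<and> distinct p"
proof -
  have "distinct (ins i x p) \<longleftrightarrow> distinct (x # take i p @ drop i p)"
    unfolding ins_def by (simp only: distinct.simps distinct_append set_append list.set) blast
  then show ?thesis by (simp only: append_take_drop_id distinct.simps)
qed

lemma ins_0: "ins 0 x p = x # p"
  by (simp add: ins_def)

lemma ins_length: "ins (length p) x p = p @ [x]"
  by (simp add: ins_def)

lemma ins_eq_iff:
  assumes "x \<notin> set p" "x \<notin> set q" "i \<le> length p" "j \<le> length q"
  shows "ins i x p = ins j x q \<longleftrightarrow> i = j \<and> p = q"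
proof
  assume eq: "ins i x p = ins j x q"
  have "x \<notin> set (take i p)" "x \<notin> set (drop i p)"
    using assms by (auto dest: in_set_takeD in_set_dropD)
  then have "take i p = take j q" "drop i p = drop j q"
    using eq unfolding ins_def by (metis append_Cons_eq_iff)+
  then show "i = j \<and> p = q"
    using assms by (metis append_take_drop_id length_take min.absorb2)
qed auto

section \<open>Jumps of the largest letter, and of smaller letters beside it\<close>

lemma jump_swap: "jump Rightward a d p q \<longleftrightarrow> jump Leftward a d q p"
  by auto

lemma jump_RightwardI:
  assumes "p = xs @ a # ys @ zs" "q = xs @ ys @ a # zs" "\<forall>y\<in>set ys. y < a" "length ys = d" "d > 0"
  shows "jump Rightward a d p q"
  unfolding jump.simps using assms by blast

lemma jump_LeftwardI:
  assumes "p = xs @ ys @ a # zs" "q = xs @ a # ys @ zs" "\<forall>y\<in>set ys. y < a" "length ys = d" "d > 0"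
  shows "jump Leftward a d p q"
  unfolding jump.simps using assms by blast

lemma jump_mem: "jump dir a d p q \<Longrightarrow> a \<in> set p"
  by (cases dir) auto

text \<open>The single occurrence of \<open>a\<close> fixes the decomposition in the definition of a
  jump, and no letter of \<open>q\<close> blocks \<open>a\<close>. So the jump is nothing but a
  change of slot.\<close>

lemma jump_right_ins:
  assumes "\<forall>y\<in>set q. y < a" "i \<le> length q"
  shows "jump Rightward a d (ins i a q) p \<longleftrightarrow> 0 < d \<and> i + d \<le> length q \<and> p = ins (i + d) a q"
proof
  assume "jump Rightward a d (ins i a q) p"
  then obtain xs ys zs where *: "d > 0" "length ys = d" "ins i a q = xs @ a # ys @ zs"
      "p = xs @ ys @ a # zs"
    by auto
  have "a \<notin> set (take i q)" "a \<notin> set (drop i q)"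
    using assms by (auto dest: in_set_takeD in_set_dropD)
  then have **: "take i q = xs" "drop i q = ys @ zs"
    using *(3) unfolding ins_def by (metis append_Cons_eq_iff)+
  then have q: "q = xs @ ys @ zs" by (metis append_take_drop_id)
  have "length xs = i" using **(1) assms(2) by auto
  then show "0 < d \<and> i + d \<le> length q \<and> p = ins (i + d) a q"
    using * q by (auto simp: ins_def)
next
  assume *: "0 < d \<and> i + d \<le> length q \<and> p = ins (i + d) a q"
  have "ins i a q = take i q @ a # take d (drop i q) @ drop (i + d) q"
    by (metis add.commute append_take_drop_id drop_drop ins_def)
  moreover have "p = take i q @ take d (drop i q) @ a # drop (i + d) q"
    using * by (simp add: ins_def take_add)
  moreover have "\<forall>y\<in>set (take d (drop i q)). y < a"
    using assms(1) by (auto dest: in_set_takeD in_set_dropD)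
  ultimately show "jump Rightward a d (ins i a q) p" using *
    by (intro jump_RightwardI) auto
qed

lemma jump_left_ins:
  assumes "\<forall>y\<in>set q. y < a" "i \<le> length q"
  shows "jump Leftward a d (ins i a q) p \<longleftrightarrow> 0 < d \<and> d \<le> i \<and> p = ins (i - d) a q"
proof
  assume "jump Leftward a d (ins i a q) p"
  then obtain xs ys zs where *: "d > 0" "length ys = d" "ins i a q = xs @ ys @ a # zs"
      "p = xs @ a # ys @ zs"
    by auto
  have "a \<notin> set (take i q)" "a \<notin> set (drop i q)"
    using assms by (auto dest: in_set_takeD in_set_dropD)
  then have **: "take i q = xs @ ys" "drop i q = zs"
    using *(3) unfolding ins_def by (metis append_Cons_eq_iff append.assoc)+
  then have q: "q = xs @ ys @ zs" by (metis append_take_drop_id append.assoc)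
  have "i = length xs + d" using **(1) assms(2) *(2) by (metis length_append length_take min.absorb2)
  then show "0 < d \<and> d \<le> i \<and> p = ins (i - d) a q"
    using * q by (auto simp: ins_def)
next
  assume *: "0 < d \<and> d \<le> i \<and> p = ins (i - d) a q"
  then have "jump Rightward a d p (ins i a q)"
    using assms by (simp del: jump.simps add: jump_right_ins)
  then show "jump Leftward a d (ins i a q) p"
    using jump_swap by blast
qed

text \<open>A letter \<open>b > a\<close> cannot be jumped over by \<open>a\<close>, so in front of
  the word it stays put and leaves all jumps of \<open>a\<close> in the rest unchanged.\<close>

lemma jump_Cons:
  assumes "a < b"
  shows "jump dir a d (b # q) p \<longleftrightarrow> (\<exists>q'. p = b # q' \<and> jump dir a d q q')"
proof (cases dir)
  case Rightward
  show ?thesis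
  proof
    assume "jump dir a d (b # q) p"
    then obtain xs ys zs where *: "d > 0" "length ys = d" "b # q = xs @ a # ys @ zs"
        "p = xs @ ys @ a # zs" "\<forall>y\<in>set ys. y < a"
      using Rightward by auto
    then obtain xs' where "xs = b # xs'" using assms by (cases xs) auto
    then show "\<exists>q'. p = b # q' \<and> jump dir a d q q'" using * Rightward by auto
  next
    assume "\<exists>q'. p = b # q' \<and> jump dir a d q q'"
    then obtain xs ys zs where "d > 0" "length ys = d" "q = xs @ a # ys @ zs"
        "p = b # xs @ ys @ a # zs" "\<forall>y\<in>set ys. y < a"
      using Rightward by auto
    then show "jump dir a d (b # q) p"
      unfolding Rightward by (intro jump_RightwardI[of _ "b # xs"]) auto
  qed
next
  case Leftward
  show ?thesis
  proof
    assume "jump dir a d (b # q) p"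
    then obtain xs ys zs where *: "d > 0" "length ys = d" "b # q = xs @ ys @ a # zs"
        "p = xs @ a # ys @ zs" "\<forall>y\<in>set ys. y < a"
      using Leftward by auto
    then obtain xs' where "xs = b # xs'" using assms by (cases xs; cases ys) auto
    then show "\<exists>q'. p = b # q' \<and> jump dir a d q q'" using * Leftward by auto
  next
    assume "\<exists>q'. p = b # q' \<and> jump dir a d q q'"
    then obtain xs ys zs where "d > 0" "length ys = d" "q = xs @ ys @ a # zs"
        "p = b # xs @ a # ys @ zs" "\<forall>y\<in>set ys. y < a"
      using Leftward by auto
    then show "jump dir a d (b # q) p"
      unfolding Leftward by (intro jump_LeftwardI[of _ "b # xs"]) auto
  qed
qed

text \<open>Reversal exchanges the two directions; this turns \<open>jump_Cons\<close> into its
  mirror image \<open>jump_snoc\<close>.\<close>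

lemma jump_rev:
  "jump Rightward a d (rev p) (rev q) \<longleftrightarrow> jump Leftward a d p q"
proof
  assume "jump Rightward a d (rev p) (rev q)"
  then obtain xs ys zs where *: "d > 0" "length ys = d" "rev p = xs @ a # ys @ zs"
        "rev q = xs @ ys @ a # zs" "\<forall>y\<in>set ys. y < a"
    by auto
  have "p = rev zs @ rev ys @ a # rev xs" "q = rev zs @ a # rev ys @ rev xs"
    using *(3,4) by (simp_all add: rev_swap)
  then show "jump Leftward a d p q"
    using * by (intro jump_LeftwardI[of _ "rev zs" "rev ys" _ "rev xs"]) auto
next
  assume "jump Leftward a d p q"
  then obtain xs ys zs where *: "d > 0" "length ys = d" "p = xs @ ys @ a # zs"
        "q = xs @ a # ys @ zs" "\<forall>y\<in>set ys. y < a"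
    by auto
  then show "jump Rightward a d (rev p) (rev q)"
    by (intro jump_RightwardI[of _ "rev zs" _ "rev ys" "rev xs"]) auto
qed

lemma jump_rev_Leftward:
  "jump Leftward a d (rev p) (rev q) \<longleftrightarrow> jump Rightward a d p q"
  by (metis jump_rev rev_rev_ident)

lemma jump_snoc:
  assumes "a < b"
  shows "jump dir a d (q @ [b]) p \<longleftrightarrow> (\<exists>q'. p = q' @ [b] \<and> jump dir a d q q')"
proof (cases dir)
  case Rightward
  have "jump dir a d (q @ [b]) p \<longleftrightarrow> jump Leftward a d (b # rev q) (rev p)"
    using jump_rev_Leftward[of a d "q @ [b]" p] Rightward by (simp del: jump.simps)
  also have "\<dots> \<longleftrightarrow> (\<exists>q'. rev p = b # q' \<and> jump Leftward a d (rev q) q')"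
    by (rule jump_Cons[OF assms])
  also have "\<dots> \<longleftrightarrow> (\<exists>q'. rev p = b # rev q' \<and> jump Leftward a d (rev q) (rev q'))"
    by (metis rev_rev_ident)
  also have "\<dots> \<longleftrightarrow> (\<exists>q'. p = q' @ [b] \<and> jump dir a d q q')"
    unfolding jump_rev_Leftward using Rightward by (metis rev.simps(2) rev_rev_ident)
  finally show ?thesis .
next
  case Leftward
  have "jump dir a d (q @ [b]) p \<longleftrightarrow> jump Rightward a d (b # rev q) (rev p)"
    using jump_rev[of a d "q @ [b]" p] Leftward by (simp del: jump.simps)
  also have "\<dots> \<longleftrightarrow> (\<exists>q'. rev p = b # q' \<and> jump Rightward a d (rev q) q')"
    by (rule jump_Cons[OF assms])
  also have "\<dots> \<longleftrightarrow> (\<exists>q'. rev p = b # rev q' \<and> jump Rightward a d (rev q) (rev q'))"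
    by (metis rev_rev_ident)
  also have "\<dots> \<longleftrightarrow> (\<exists>q'. p = q' @ [b] \<and> jump dir a d q q')"
    unfolding jump_rev using Leftward by (metis rev.simps(2) rev_rev_ident)
  finally show ?thesis .
qed

lemma jump_set: "jump dir a d p q \<Longrightarrow> set q = set p"
  by (cases dir) auto

lemma jump_length: "jump dir a d p q \<Longrightarrow> length q = length p"
  by (cases dir) auto

lemma jump_ins_end:
  assumes "a < b" "e = 0 \<or> e = length q"
  shows "jump dir a d (ins e b q) p \<longleftrightarrow> (\<exists>q'. p = ins e b q' \<and> jump dir a d q q')"
  using assms(2)
proof
  assume "e = 0"
  then show ?thesis using jump_Cons[OF assms(1)] by (simp del: jump.simps add: ins_0)
next
  assume "e = length q"
  then show ?thesis using jump_snoc[OF assms(1), of dir d q p] jump_length[of dir a d q]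
    by (metis ins_length)
qed

section \<open>Traversing fibres alternately backwards and forwards\<close>

fun zigzag :: "bool \<Rightarrow> ('a \<Rightarrow> 'b list) \<Rightarrow> 'a list \<Rightarrow> 'b list" where
  "zigzag b f [] = []"
| "zigzag b f (x # xs) = (if b then rev (f x) else f x) @ zigzag (\<not> b) f xs"

lemma set_zigzag: "set (zigzag b f xs) = (\<Union>x\<in>set xs. set (f x))"
  by (induction xs arbitrary: b) auto

lemma distinct_zigzag:
  assumes "distinct xs" "\<And>x. x \<in> set xs \<Longrightarrow> distinct (f x)"
    "\<And>x y. x \<in> set xs \<Longrightarrow> y \<in> set xs \<Longrightarrow> x \<noteq> y \<Longrightarrow> set (f x) \<inter> set (f y) = {}"
  shows "distinct (zigzag b f xs)"
  using assms
proof (induction xs arbitrary: b)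
  case (Cons x xs)
  then have "distinct (zigzag (\<not> b) f xs)" by simp
  moreover have "set (f x) \<inter> set (f y) = {}" if "y \<in> set xs" for y
    using Cons.prems(1) Cons.prems(3)[of x y] that by auto
  ultimately show ?case using Cons.prems(2)[of x] by (auto simp: set_zigzag)
qed simp

text \<open>The flag alternates, so neighbouring fibres always meet at equal ends: both at their
  heads or both at their last entries. Symmetry of \<open>S\<close> covers the fibres that are read
  backwards.\<close>

lemma successively_zigzag:
  assumes "successively R xs"
    "\<And>x. x \<in> set xs \<Longrightarrow> f x \<noteq> [] \<and> successively S (f x)"
    "\<And>x y. x \<in> set xs \<Longrightarrow> y \<in> set xs \<Longrightarrow> R x y \<Longrightarrow>
        S (hd (f x)) (hd (f y)) \<and> S (last (f x)) (last (f y))"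
    "symp S"
  shows "successively S (zigzag b f xs)"
  using assms(1-3)
proof (induction xs arbitrary: b)
  case (Cons x xs)
  have "successively S (rev (f x))"
    using Cons.prems(2)[of x] assms(4) successively_rev[of S "f x"]
    by (metis list.set_intros(1) sympE successively_mono)
  moreover have IH: "successively S (zigzag (\<not> b) f xs)"
    using Cons by (auto simp: successively_Cons)
  moreover have "S (last (if b then rev (f x) else f x)) (hd (zigzag (\<not> b) f xs))" if ne: "xs \<noteq> []"
  proof -
    obtain y ys where xs: "xs = y # ys" using ne by (cases xs) auto
    then have "R x y" using Cons.prems(1) by simp
    then have "S (hd (f x)) (hd (f y)) \<and> S (last (f x)) (last (f y))" "f x \<noteq> []" "f y \<noteq> []"
      using Cons.prems(2,3) xs by auto
    then show ?thesis by (auto simp: xs last_rev hd_rev)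
  qed
  moreover have "zigzag (\<not> b) f [] = []" by simp
  ultimately show ?case
    using Cons.prems(2)[of x] by (cases "xs = []") (auto simp: successively_append_iff)
qed simp

text \<open>A prefix stops inside the block of some \<open>q\<close>: the blocks of
  \<open>us\<close> are complete, and \<open>f2\<close> is what remains of the block of
  \<open>q\<close>. As \<open>f1\<close> is nonempty, the last entry of the prefix belongs to
  \<open>q\<close>.\<close>

lemma zigzag_eq_append:
  assumes "zigzag b f qs = xs @ ys" "xs \<noteq> []"
  obtains b' us q vs f1 f2 where "qs = us @ q # vs" "f1 \<noteq> []"
    "xs = zigzag b f us @ f1" "ys = f2 @ zigzag (\<not> b') f vs"
    "f1 @ f2 = (if b' then rev (f q) else f q)"
  using assms
proof (induction qs arbitrary: b xs thesis)
  case (Cons q qs)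
  define F where "F = (if b then rev (f q) else f q)"
  have eq: "F @ zigzag (\<not> b) f qs = xs @ ys" using Cons.prems(2) by (simp add: F_def)
  show ?case
  proof (cases "\<exists>us. F @ us = xs \<and> us \<noteq> []")
    case True
    then obtain us where us: "F @ us = xs" "us \<noteq> []" by auto
    with eq have "zigzag (\<not> b) f qs = us @ ys" by auto
    from Cons.IH[OF _ this us(2)] obtain b' us' q' vs f1 f2 where
      "qs = us' @ q' # vs" "f1 \<noteq> []"
      "us = zigzag (\<not> b) f us' @ f1" "ys = f2 @ zigzag (\<not> b') f vs"
      "f1 @ f2 = (if b' then rev (f q') else f q')" by metis
    then show ?thesis
      by (intro Cons.prems(1)[of "q # us'" q' vs f1 f2 b']) (use us F_def in auto)
  next
    case False
    then obtain f2 where "F = xs @ f2" "ys = f2 @ zigzag (\<not> b) f qs"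
      using eq by (auto simp: append_eq_append_conv2)
    then show ?thesis
      by (intro Cons.prems(1)[of "[]" q qs xs f2 b]) (use F_def Cons.prems(3) in auto)
  qed
qed simp

text \<open>A certificate for a full run: uniqueness of each step makes the \<open>THE\<close> in
  \<open>algorithm_J\<close> denote the next entry, and the case \<open>ys = []\<close> is
  termination.\<close>

definition J_sequence :: "nat list set \<Rightarrow> nat list list \<Rightarrow> bool" where
  "J_sequence L ps \<longleftrightarrow> ps \<noteq> [] \<and> (\<forall>xs ys. ps = xs @ ys \<longrightarrow> xs \<noteq> [] \<longrightarrow>
     (\<forall>q. J_step L xs q \<longleftrightarrow> ys \<noteq> [] \<and> q = hd ys))"

lemma algorithm_J_eq:
  assumes "J_sequence L ps"
  shows "algorithm_J L (hd ps) = Some ps"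
proof -
  define b where "b = (\<lambda>ps. \<exists>q. J_step L ps q)"
  define c where "c = (\<lambda>ps. ps @ [THE q. J_step L ps q])"
  have step: "\<And>xs ys q. ps = xs @ ys \<Longrightarrow> xs \<noteq> [] \<Longrightarrow> J_step L xs q \<longleftrightarrow> ys \<noteq> [] \<and> q = hd ys"
    using assms unfolding J_sequence_def by blast
  \<comment> \<open>The loop starts with one visited word, so \<open>k\<close> rounds produce the
    prefix of length \<open>Suc k\<close>.\<close>
  have iter: "(c ^^ k) [hd ps] = take (Suc k) ps" if "k < length ps" for k
    using that
  proof (induction k)
    case 0
    then show ?case by (cases ps) auto
  next
    case (Suc k)
    have "J_step L (take (Suc k) ps) q \<longleftrightarrow> q = ps ! Suc k" for q
      using step[of "take (Suc k) ps" "drop (Suc k) ps"] Suc.prems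
      by (cases ps) (auto simp: hd_drop_conv_nth)
    then have "(THE q. J_step L (take (Suc k) ps) q) = ps ! Suc k" by simp
    then show ?case using Suc by (simp add: c_def take_Suc_conv_app_nth[of "Suc k"])
  qed
  have "J_step L (take (Suc k) ps) q \<longleftrightarrow> Suc k < length ps \<and> q = hd (drop (Suc k) ps)"
    if "k < length ps" for k q
    using step[of "take (Suc k) ps" "drop (Suc k) ps" q] that by (cases ps) auto
  then have "b (take (Suc k) ps) \<longleftrightarrow> Suc k < length ps" if "k < length ps" for k
    unfolding b_def using that by blast
  then have stop: "b ((c ^^ k) [hd ps]) \<longleftrightarrow> Suc k < length ps" if "k < length ps" for k
    using iter that by simp
  have ne: "ps \<noteq> []" using assms by (simp add: J_sequence_def)
  have "(LEAST k. \<not> b ((c ^^ k) [hd ps])) = length ps - 1"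
  proof (rule Least_equality)
    show "\<not> b ((c ^^ (length ps - 1)) [hd ps])"
      using stop[of "length ps - 1"] ne by simp
    show "length ps - 1 \<le> k" if "\<not> b ((c ^^ k) [hd ps])" for k
      using stop[of k] that by (cases "k < length ps") auto
  qed
  moreover have "\<exists>k. \<not> b ((c ^^ k) [hd ps])"
    using stop[of "length ps - 1"] ne by auto
  ultimately have "while_option b c [hd ps] = Some ((c ^^ (length ps - 1)) [hd ps])"
    unfolding while_option_def by simp
  also have "\<dots> = Some ps" using iter[of "length ps - 1"] ne by simp
  finally show ?thesis unfolding algorithm_J_def b_def c_def .
qed

section \<open>Sweeping the largest letter through the fibres\<close>

definition dir_to :: "nat \<Rightarrow> nat \<Rightarrow> direction" where
  "dir_to i j = (if i < j then Rightward else Leftward)"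

definition steps_to :: "nat \<Rightarrow> nat \<Rightarrow> nat" where
  "steps_to i j = (if i < j then j - i else i - j)"

lemma jump_ins:
  assumes "\<forall>y\<in>set q. y < a" "i \<le> length q"
  shows "jump dir a d (ins i a q) p \<longleftrightarrow>
    (\<exists>j\<le>length q. j \<noteq> i \<and> dir = dir_to i j \<and> d = steps_to i j \<and> p = ins j a q)"
proof (cases dir)
  case Rightward
  have "(0 < d \<and> i + d \<le> length q \<and> p = ins (i + d) a q) \<longleftrightarrow>
    (\<exists>j\<le>length q. j \<noteq> i \<and> dir = dir_to i j \<and> d = steps_to i j \<and> p = ins j a q)"
    unfolding dir_to_def steps_to_def Rightward
    by (auto split: if_splits intro!: exI[of _ "i + d"])
  then show ?thesis using jump_right_ins[OF assms] Rightward by (simp del: jump.simps)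
next
  case Leftward
  have "(0 < d \<and> d \<le> i \<and> p = ins (i - d) a q) \<longleftrightarrow>
    (\<exists>j\<le>length q. j \<noteq> i \<and> dir = dir_to i j \<and> d = steps_to i j \<and> p = ins j a q)"
    unfolding dir_to_def steps_to_def Leftward using assms(2)
    by (auto split: if_splits intro!: exI[of _ "i - d"])
  then show ?thesis using jump_left_ins[OF assms] Leftward by (simp del: jump.simps)
qed

text \<open>While the current fibre has unvisited slots, they all lie ahead of \<open>Suc m\<close>
  in the direction of the sweep, and the minimal jump leads to the nearest one. Once the fibre is
  exhausted, \<open>Suc m\<close> stands at an end whose slot occurs in every fibre, so smaller
  values jump as in \<open>L'\<close>. The case \<open>z = m\<close> forces every fibre to be a
  single word.\<close>

lemma J_sequence_zigzag:
  fixes L' :: "nat list set" and P :: "nat list \<Rightarrow> nat list" and m z :: nat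
  defines "f \<equiv> \<lambda>q. map (\<lambda>i. ins i (Suc m) q) (P q)"
  assumes J: "J_sequence L' qs" and qs: "distinct qs" "set qs = L'"
    and word: "\<And>q. q \<in> L' \<Longrightarrow> length q = m \<and> (\<forall>y\<in>set q. y < Suc m)"
    and P: "\<And>q. q \<in> L' \<Longrightarrow> P q \<noteq> [] \<and> sorted_wrt (<) (P q) \<and> hd (P q) = z \<and> last (P q) = m"
    and z: "z = 0 \<or> z = m"
    and L: "L = {ins i (Suc m) q | q i. q \<in> L' \<and> i \<in> set (P q)}"
  shows "J_sequence L (zigzag b f qs)"
  unfolding J_sequence_def
proof (intro conjI allI impI)
  obtain q qs' where "qs = q # qs'" using J unfolding J_sequence_def by (cases qs) auto
  moreover from this have "f q \<noteq> []" using P[of q] qs by (auto simp: f_def)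
  ultimately show "zigzag b f qs \<noteq> []" by simp
next
  fix xs ys p
  assume eq: "zigzag b f qs = xs @ ys" and ne: "xs \<noteq> []"
  define N where "N = Suc m"
  define g where "g = (\<lambda>q i. ins i N q)"
  have f: "f q = map (g q) (P q)" for q by (simp add: f_def g_def N_def)
  obtain b' us q vs f1 f2 where split: "qs = us @ q # vs" "f1 \<noteq> []"
    "xs = zigzag b f us @ f1" "ys = f2 @ zigzag (\<not> b') f vs"
    "f1 @ f2 = (if b' then rev (f q) else f q)"
    using zigzag_eq_append[OF eq ne] by metis
  define F where "F = (if b' then rev (P q) else P q)"
  have "f1 @ f2 = map (g q) F" using split(5) by (simp add: f F_def rev_map)
  \<comment> \<open>\<open>s1\<close> lists the slots of the current fibre visited so far and
    \<open>s2\<close> those still to come, in the order of the sweep.\<close>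
  then obtain s1 s2 where s: "F = s1 @ s2" "f1 = map (g q) s1" "f2 = map (g q) s2"
    by (metis append_eq_map_conv)
  have s1: "s1 \<noteq> []" using s split(2) by auto
  have setP: "set (P q) = set s1 \<union> set s2" using s(1) by (metis F_def set_append set_rev)
  define i where "i = last s1"
  have last: "last xs = ins i N q"
    using split(2,3) s s1 by (simp add: g_def i_def last_map)
  have q: "q \<in> L'" using split(1) qs by auto
  have q_us: "q \<notin> set us" using split(1) qs by auto
  have us: "set us \<subseteq> L'" using split(1) qs by auto
  have le: "j \<le> m" if "q' \<in> L'" "j \<in> set (P q')" for q' j
  proof -
    have "P q' = butlast (P q') @ [m]" using P[OF that(1)] by (metis append_butlast_last_id)
    then have "sorted_wrt (<) (butlast (P q') @ [m])" using P[OF that(1)] by metis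
    then have "\<forall>j\<in>set (butlast (P q') @ [m]). j \<le> m" by (auto simp: sorted_wrt_append less_imp_le)
    then show ?thesis using that(2) \<open>P q' = butlast (P q') @ [m]\<close> by metis
  qed
  have i: "i \<in> set (P q)" "i \<in> set s1" using s1 setP by (auto simp: i_def)
  then have i_le: "i \<le> length q" using le[OF q] word[OF q] by auto
  have ins_eq: "ins j N q' = ins k N q'' \<longleftrightarrow> j = k \<and> q' = q''"
    if "length q' = m" "\<forall>y\<in>set q'. y < N" "j \<le> m" "q'' \<in> L'" "k \<in> set (P q'')" for j k q' q''
    using that word[of q''] le[of q'' k] by (intro ins_eq_iff) (auto simp: N_def)
  have in_L: "ins j N q' \<in> L \<longleftrightarrow> q' \<in> L' \<and> j \<in> set (P q')"
    if "length q' = m" "\<forall>y\<in>set q'. y < N" "j \<le> m" for j q'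
    unfolding L using ins_eq[OF that] by (auto simp: N_def)
  have in_xs: "ins j N q' \<in> set xs \<longleftrightarrow>
      q' \<in> set us \<and> j \<in> set (P q') \<or> q' = q \<and> j \<in> set s1"
    if "length q' = m" "\<forall>y\<in>set q'. y < N" "j \<le> m" for j q'
  proof -
    have "ins j N q' \<in> set xs \<longleftrightarrow>
      (\<exists>u\<in>set us. \<exists>k\<in>set (P u). ins j N q' = ins k N u) \<or> (\<exists>k\<in>set s1. ins j N q' = ins k N q)"
      by (auto simp: split(3) set_zigzag f g_def s)
    then show ?thesis using ins_eq[OF that] us q setP by blast
  qed
  have wq: "length q = m" "\<forall>y\<in>set q. y < N" using word[OF q] by (auto simp: N_def)
  have jumpN: "jump dir N d (last xs) p' \<longleftrightarrow>
      (\<exists>j\<le>m. j \<noteq> i \<and> dir = dir_to i j \<and> d = steps_to i j \<and> p' = ins j N q)" for dir d p'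
    using jump_ins[OF wq(2) i_le] wq(1) unfolding last by simp
  \<comment> \<open>No value exceeds \<open>N\<close>, so the step is decided by \<open>N\<close>
    whenever \<open>N\<close> can jump to an unvisited word.\<close>
  have le_N: "a \<le> N" if "jump_to_new L xs dir a p'" for dir a p'
    using that wq(2) jump_mem[of dir a _ "last xs"]
    unfolding jump_to_new_def minimal_jump_def last by fastforce
  show "J_step L xs p \<longleftrightarrow> ys \<noteq> [] \<and> p = hd ys"
  proof (cases "s2 = []")
    case False
    define i' where "i' = hd s2"
    have hd: "ys \<noteq> []" "hd ys = ins i' N q"
      using False by (simp_all add: split(4) s i'_def hd_map g_def)
    have i': "i' \<in> set s2" using False by (simp add: i'_def)
    \<comment> \<open>Slots in \<open>s2\<close> other than \<open>i'\<close> lie beyond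
      \<open>i'\<close> as seen from \<open>i\<close>; visited slots other than \<open>i\<close> lie
      on the opposite side of \<open>i\<close>. So the direction is never ambiguous.\<close>
    have order: "i \<noteq> i' \<and> i' \<notin> set s1 \<and>
        (\<forall>j\<in>set s2. j \<noteq> i' \<longrightarrow> dir_to i j = dir_to i i' \<and> steps_to i i' < steps_to i j) \<and>
        (\<forall>j\<in>set s1. j \<noteq> i \<longrightarrow> dir_to i j \<noteq> dir_to i i')"
    proof -
      obtain t1 where t1: "s1 = t1 @ [i]" using s1 unfolding i_def by (metis append_butlast_last_id)
      obtain t2 where t2: "s2 = i' # t2" using False unfolding i'_def by (metis list.collapse)
      have "sorted_wrt (<) (P q)" using P[OF q] by blast
      moreover have "P q = (if b' then rev t2 @ i' # i # rev t1 else t1 @ i # i' # t2)"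
        using s(1) t1 t2 unfolding F_def by (auto simp: rev_swap split: if_splits)
      ultimately have "if b' then i' < i \<and> (\<forall>j\<in>set t2. j < i') \<and> (\<forall>j\<in>set t1. i < j)
          else i < i' \<and> (\<forall>j\<in>set t2. i' < j) \<and> (\<forall>j\<in>set t1. j < i)"
        by (auto simp: sorted_wrt_append)
      then have "i \<noteq> i'" and s1_i: "\<forall>j\<in>set s1. j \<noteq> i \<longrightarrow> (i < j \<longleftrightarrow> \<not> i < i') \<and> j \<noteq> i'"
        and s2_i: "\<forall>j\<in>set s2. j \<noteq> i' \<longrightarrow> (if i < i' then i' < j else j < i' \<and> i' < i)"
        unfolding t1 t2 by (auto split: if_splits)
      have "dir_to i j = dir_to i i' \<and> steps_to i i' < steps_to i j" if "j \<in> set s2" "j \<noteq> i'" for j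
        using s2_i that \<open>i \<noteq> i'\<close> unfolding dir_to_def steps_to_def by (cases "i < i'") auto
      moreover have "dir_to i j \<noteq> dir_to i i'" if "j \<in> set s1" "j \<noteq> i" for j
        using s1_i that unfolding dir_to_def by auto
      ultimately show ?thesis using \<open>i \<noteq> i'\<close> s1_i by metis
    qed
    have new: "jump_to_new L xs dir N p' \<longleftrightarrow> dir = dir_to i i' \<and> p' = ins i' N q" for dir p'
    proof
      assume *: "jump_to_new L xs dir N p'"
      then obtain j where j: "j \<le> m" "j \<noteq> i" "dir = dir_to i j" "p' = ins j N q"
        and min: "\<And>d' q'. d' < steps_to i j \<Longrightarrow> jump dir N d' (last xs) q' \<Longrightarrow> q' \<notin> L"
        unfolding jump_to_new_def minimal_jump_def jumpN by metis
      have "p' \<in> L" "p' \<notin> set xs" using * by (auto simp: jump_to_new_def)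
      then have "j \<in> set s2"
        using in_L[OF wq j(1)] in_xs[OF wq j(1)] setP unfolding j(4) by auto
      have "j = i'"
      proof (rule ccontr)
        assume "j \<noteq> i'"
        then have "dir_to i j = dir_to i i'" "steps_to i i' < steps_to i j"
          using order \<open>j \<in> set s2\<close> by auto
        moreover have "ins i' N q \<in> L" "i' \<le> m"
          using in_L[OF wq, of i'] q setP i' le[OF q, of i'] by auto
        ultimately show False using min[of "steps_to i i'" "ins i' N q"] order
          unfolding jumpN j(3) by metis
      qed
      then show "dir = dir_to i i' \<and> p' = ins i' N q" using j by simp
    next
      assume *: "dir = dir_to i i' \<and> p' = ins i' N q"
      have i'm: "i' \<in> set (P q)" "i' \<le> m" using setP i' le[OF q, of i'] by auto
      have "jump dir N (steps_to i i') (last xs) p'"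
        unfolding jumpN using * order i'm by metis
      \<comment> \<open>A shorter jump in this direction into \<open>L\<close> would end at a slot
        of the current fibre: not in \<open>s1\<close>, whose other slots lie in the opposite
        direction, and not in \<open>s2\<close>, where \<open>i'\<close> is the nearest.\<close>
      moreover have "q' \<notin> L" if d': "d' < steps_to i i'" "jump dir N d' (last xs) q'" for d' q'
      proof
        assume "q' \<in> L"
        obtain j where j: "j \<le> m" "j \<noteq> i" "dir = dir_to i j" "d' = steps_to i j" "q' = ins j N q"
          using d'(2) unfolding jumpN by blast
        then have "j \<in> set (P q)" using \<open>q' \<in> L\<close> in_L[OF wq j(1)] by simp
        then have "steps_to i i' \<le> steps_to i j"
          using order j(2,3) * setP by (cases "j = i'") (auto dest: less_imp_le)
        then show False using d'(1) j(4) by simp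
      qed
      moreover have "p' \<in> L" "p' \<notin> set xs"
        using * in_L[OF wq i'm(2)] in_xs[OF wq i'm(2)] i'm q q_us order by auto
      ultimately show "jump_to_new L xs dir N p'"
        unfolding jump_to_new_def minimal_jump_def by blast
    qed
    then have "J_step L xs p \<longleftrightarrow> p = ins i' N q"
      unfolding J_step_def using le_N by (metis le_antisym)
    then show ?thesis using hd by simp
  next
    \<comment> \<open>The fibre is exhausted: \<open>N\<close> rests at an end of the word without
      an unvisited target, so the step is left to a smaller value.\<close>
    case True
    have s1_eq: "s1 = (if b' then rev (P q) else P q)" using True s(1) F_def by simp
    then have i_eq: "i = (if b' then z else m)"
      using P[OF q] by (simp add: i_def last_rev)
    have i_end: "i = 0 \<or> i = length q" using z i_eq wq by auto
    \<comment> \<open>The end at which the sweep stops is a slot of every fibre, so membership in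
      \<open>L\<close> of a word with \<open>N\<close> there depends only on the smaller
      word.\<close>
    have i_in: "i \<in> set (P q')" if "q' \<in> L'" for q'
      using P[OF that] i_eq by (metis hd_in_set last_in_set)
    have noN: "\<not> jump_to_new L xs dir N p'" for dir p'
    proof
      assume *: "jump_to_new L xs dir N p'"
      then obtain j where j: "j \<le> m" "p' = ins j N q"
        unfolding jump_to_new_def minimal_jump_def jumpN by metis
      have "p' \<in> L" "p' \<notin> set xs" using * by (auto simp: jump_to_new_def)
      then show False
        using in_L[OF wq j(1)] in_xs[OF wq j(1)] setP True unfolding j(2) by auto
    qed
    have jump: "jump dir a d (last xs) p' \<longleftrightarrow> (\<exists>q'. p' = ins i N q' \<and> jump dir a d q q')"
      if "a < N" for dir a d p'
      unfolding last by (rule jump_ins_end[OF that i_end])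
    have i_m: "i \<le> m" using i_le wq by simp
    have word': "length q' = m \<and> (\<forall>y\<in>set q'. y < N)" if "jump dir a d q q'" for dir a d q'
      using jump_length[OF that] jump_set[OF that] wq by simp
    have in_L': "ins i N q' \<in> L \<longleftrightarrow> q' \<in> L'" if "jump dir a d q q'" for dir a d q'
      using in_L[of q' i] word'[OF that] i_m i_in by auto
    \<comment> \<open>The fibres of \<open>us\<close> and of \<open>q\<close> are complete, so among
      the words with \<open>N\<close> in slot \<open>i\<close> exactly those over
      \<open>us @ [q]\<close> are visited.\<close>
    have in_xs': "ins i N q' \<in> set xs \<longleftrightarrow> q' \<in> set (us @ [q])" if "jump dir a d q q'" for dir a d q'
      using in_xs[of q' i] word'[OF that] i_m i_in us i(2) by auto
    have new: "jump_to_new L xs dir a p' \<longleftrightarrow>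
        (\<exists>q'. p' = ins i N q' \<and> jump_to_new L' (us @ [q]) dir a q')" if a: "a < N" for dir a p'
    proof -
      have "(\<forall>d'<d. \<forall>q'. jump dir a d' (last xs) q' \<longrightarrow> q' \<notin> L) \<longleftrightarrow>
          (\<forall>d'<d. \<forall>q'. jump dir a d' q q' \<longrightarrow> q' \<notin> L')" for d
        unfolding jump[OF a] using in_L' by metis
      then have "minimal_jump L dir a (last xs) p' \<longleftrightarrow>
          (\<exists>q'. p' = ins i N q' \<and> minimal_jump L' dir a q q')"
        unfolding minimal_jump_def jump[OF a] by blast
      moreover have "\<exists>d. jump dir a d q q'" if "minimal_jump L' dir a q q'" for q'
        using that unfolding minimal_jump_def by blast
      ultimately show ?thesis
        unfolding jump_to_new_def using in_L' in_xs' by (metis last_snoc)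
    qed
    have lt: "a < N" if "jump_to_new L xs dir a p'" for dir a p'
      using le_N[OF that] noN that by (metis le_neq_implies_less)
    have lt': "a < N" if "jump_to_new L' (us @ [q]) dir a q'" for dir a q'
      using that wq(2) jump_mem[of dir a _ q] unfolding jump_to_new_def minimal_jump_def by auto
    have "jump_to_new L xs dir a p' \<longleftrightarrow>
        (\<exists>q'. p' = ins i N q' \<and> jump_to_new L' (us @ [q]) dir a q')" for dir a p'
      by (cases "a < N") (use new lt lt' in blast)+
    then have "J_step L xs p \<longleftrightarrow> (\<exists>q'. p = ins i N q' \<and> J_step L' (us @ [q]) q')"
      unfolding J_step_def by auto
    moreover have "J_step L' (us @ [q]) q' \<longleftrightarrow> vs \<noteq> [] \<and> q' = hd vs" for q'
      using J[unfolded J_sequence_def, THEN conjunct2, rule_format, of "us @ [q]" vs] split(1) by simp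
    \<comment> \<open>The next fibre is read in the opposite direction and hence starts at the slot
      where the present one ended.\<close>
    moreover have "ys \<noteq> [] \<and> hd ys = ins i N (hd vs)" if ne: "vs \<noteq> []"
    proof -
      obtain v vs' where v: "vs = v # vs'" using ne by (cases vs) auto
      then have "v \<in> L'" using split(1) qs by auto
      then show ?thesis
        using P[of v] i_eq v by (auto simp: split(4) s True f g_def hd_map hd_rev last_map)
    qed
    moreover have "ys = []" if "vs = []" using that by (simp add: split(4) s True)
    ultimately show ?thesis by (cases "vs = []") auto
  qed
qed

section \<open>Orientations from words\<close>

lemma arcsI: "A \<in> E \<Longrightarrow> x \<in> A \<Longrightarrow> h A \<in> A \<Longrightarrow> x \<noteq> h A \<Longrightarrow> (x, h A) \<in> arcs E h"
  unfolding arcs_def by blast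

section \<open>Positions in a word and the last letter of a hyperedge\<close>

lemma position_nth: "distinct p \<Longrightarrow> i < length p \<Longrightarrow> position p (p ! i) = Suc i"
  unfolding position_def
proof (induction p arbitrary: i)
  case (Cons a p)
  then show ?case by (cases i) auto
qed simp

lemma position_le: "x \<in> set p \<Longrightarrow> position p x \<le> length p"
  unfolding position_def by (induction p) auto

lemma position_inj: "x \<in> set p \<Longrightarrow> y \<in> set p \<Longrightarrow> distinct p \<Longrightarrow> position p x = position p y \<Longrightarrow> x = y"
  by (metis in_set_conv_nth position_nth Suc_inject)

lemma in_set_drop_iff_position:
  assumes "distinct p" "x \<in> set p"
  shows "x \<in> set (drop k p) \<longleftrightarrow> k < position p x"
proof -
  obtain i where i: "i < length p" "x = p ! i" using assms(2) by (metis in_set_conv_nth)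
  have "x \<in> set (drop k p) \<longleftrightarrow> (\<exists>j. k + j < length p \<and> p ! (k + j) = p ! i)"
    unfolding i(2) by (auto simp: in_set_conv_nth add.commute less_diff_conv)
  also have "\<dots> \<longleftrightarrow> (\<exists>j. k + j = i)"
    using i(1) assms(1) by (metis nth_eq_iff_index_eq)
  also have "\<dots> \<longleftrightarrow> k < position p x"
    using i position_nth[OF assms(1) i(1)] by (auto simp: le_iff_add less_Suc_eq_le)
  finally show ?thesis .
qed

definition top_in :: "'a list \<Rightarrow> 'a set \<Rightarrow> 'a" where
  "top_in p A = last (filter (\<lambda>x. x \<in> A) p)"

text \<open>On the encoded words this is inverse to \<open>perm_of\<close>. The restricted lambda
  makes it extensional, as membership in \<open>acyclic_orientations\<close> requires.\<close>

definition orient :: "nat set set \<Rightarrow> nat list \<Rightarrow> nat set \<Rightarrow> nat" where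
  "orient E p = (\<lambda>A\<in>E. top_in p A)"

lemma top_in_mem:
  assumes "A \<inter> set p \<noteq> {}"
  shows "top_in p A \<in> A" "top_in p A \<in> set p"
proof -
  have "filter (\<lambda>x. x \<in> A) p \<noteq> []" using assms by (auto simp: filter_empty_conv)
  then have "top_in p A \<in> set (filter (\<lambda>x. x \<in> A) p)" unfolding top_in_def by (rule last_in_set)
  then show "top_in p A \<in> A" "top_in p A \<in> set p" by auto
qed

lemma position_le_top_in:
  assumes "distinct p" "x \<in> A" "x \<in> set p"
  shows "position p x \<le> position p (top_in p A)"
proof -
  let ?f = "filter (\<lambda>x. x \<in> A) p"
  have "sorted_wrt (\<lambda>x y. position p x < position p y) p"
    unfolding sorted_wrt_iff_nth_less using position_nth[OF assms(1)] by auto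
  then have "sorted_wrt (\<lambda>x y. position p x < position p y) ?f" by (rule sorted_wrt_filter)
  moreover have x: "x \<in> set ?f" using assms by simp
  then have "?f = butlast ?f @ [top_in p A]"
    unfolding top_in_def by (metis append_butlast_last_id empty_iff list.set(1))
  ultimately show ?thesis using x
    by (metis (no_types, lifting) Un_iff empty_iff less_imp_le list.set(1,2) order_refl set_append
        insert_iff sorted_wrt_append)
qed

lemma top_in_eqI:
  assumes "distinct p" "t \<in> A" "t \<in> set p"
    "\<And>x. x \<in> A \<Longrightarrow> x \<in> set p \<Longrightarrow> position p x \<le> position p t"
  shows "top_in p A = t"
proof -
  have *: "A \<inter> set p \<noteq> {}" using assms by auto
  have "position p (top_in p A) = position p t"
    using position_le_top_in[OF assms(1-3)] assms(4)[OF top_in_mem[OF *]] by simp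
  then show ?thesis using position_inj[OF top_in_mem(2)[OF *] assms(3,1)] by simp
qed

text \<open>If \<open>A - {N}\<close> meets \<open>q\<close>, only \<open>N\<close> and the former
  last letter of \<open>A - {N}\<close> can be last. That letter stands behind \<open>N\<close> iff
  its position, counted from 1, exceeds the number \<open>k\<close> of letters in front of
  \<open>N\<close>.\<close>

lemma top_in_ins:
  assumes "N \<notin> set q"
  shows "N \<notin> A \<Longrightarrow> top_in (ins k N q) A = top_in q A"
    and "N \<in> A \<Longrightarrow> distinct q \<Longrightarrow> (A - {N}) \<inter> set q \<noteq> {} \<Longrightarrow> top_in (ins k N q) A =
      (if k < position q (top_in q (A - {N})) then top_in q (A - {N}) else N)"
    and "N \<in> A \<Longrightarrow> (A - {N}) \<inter> set q = {} \<Longrightarrow> top_in (ins k N q) A = N"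
proof -
  have q: "q = take k q @ drop k q" by simp
  show "top_in (ins k N q) A = top_in q A" if "N \<notin> A"
  proof -
    have "filter (\<lambda>x. x \<in> A) (ins k N q) = filter (\<lambda>x. x \<in> A) (take k q @ drop k q)"
      unfolding ins_def filter_append using that by simp
    then show ?thesis by (simp add: top_in_def)
  qed
  have f: "filter (\<lambda>x. x \<in> A - {N}) xs = filter (\<lambda>x. x \<in> A) xs" if "set xs \<subseteq> set q" for xs
    using that assms by (intro filter_cong) auto
  show "top_in (ins k N q) A =
      (if k < position q (top_in q (A - {N})) then top_in q (A - {N}) else N)"
    if "N \<in> A" "distinct q" and ne: "(A - {N}) \<inter> set q \<noteq> {}"
  proof (cases "filter (\<lambda>x. x \<in> A) (drop k q) = []")
    case True
    then have "top_in q (A - {N}) \<notin> set (drop k q)"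
      using top_in_mem(1)[OF ne] by (auto simp: filter_empty_conv)
    moreover have "top_in (ins k N q) A = N"
      using True that(1) by (simp add: top_in_def ins_def)
    ultimately show ?thesis
      using in_set_drop_iff_position[OF that(2) top_in_mem(2)[OF ne]] by simp
  next
    case False
    then have 1: "top_in (ins k N q) A = last (filter (\<lambda>x. x \<in> A) (drop k q))"
      using that(1) by (simp add: top_in_def ins_def)
    have "filter (\<lambda>x. x \<in> A - {N}) q = filter (\<lambda>x. x \<in> A) (take k q) @ filter (\<lambda>x. x \<in> A) (drop k q)"
      using f[of q] by (metis filter_append q subset_refl)
    then have 2: "top_in q (A - {N}) = last (filter (\<lambda>x. x \<in> A) (drop k q))"
      using False unfolding top_in_def by simp
    have "top_in q (A - {N}) \<in> set (drop k q)"
      unfolding 2 using last_in_set[OF False] by simp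
    then show ?thesis
      using 1 2 in_set_drop_iff_position[OF that(2) top_in_mem(2)[OF ne]] by simp
  qed
  show "top_in (ins k N q) A = N" if "N \<in> A" "(A - {N}) \<inter> set q = {}"
  proof -
    have "filter (\<lambda>x. x \<in> A) (drop k q) = []"
      using that(2) assms by (auto simp: filter_empty_conv dest: in_set_dropD)
    then show ?thesis using that(1) by (simp add: top_in_def ins_def)
  qed
qed

text \<open>Every arc leads from an earlier to a later letter, and this relation is transitive. So
  \<open>p\<close> is a linear extension of the poset, which gives acyclicity in
  \<open>orient_acyclic\<close>.\<close>

lemma poset_orient_subset:
  assumes "distinct p" "\<And>A. A \<in> E \<Longrightarrow> A \<subseteq> set p"
  shows "poset E (orient E p) \<subseteq> {(x, y). position p x < position p y}"
proof -
  have "arcs E (orient E p) \<subseteq> {(x, y). position p x < position p y}"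
  proof (clarsimp simp: arcs_def orient_def)
    fix x A assume *: "x \<noteq> top_in p A" "A \<in> E" "x \<in> A" "top_in p A \<in> A"
    then have "position p x \<le> position p (top_in p A)"
      using position_le_top_in[OF assms(1), of x A] assms(2) by auto
    moreover have "position p x \<noteq> position p (top_in p A)"
      using position_inj[of x p "top_in p A"] * assms by auto
    ultimately show "position p x < position p (top_in p A)" by simp
  qed
  then have "poset E (orient E p) \<subseteq> {(x, y). position p x < position p y}\<^sup>+"
    unfolding poset_def by (rule trancl_mono_subset)
  also have "\<dots> = {(x, y). position p x < position p y}"
    by (intro trancl_id transI) auto
  finally show ?thesis .
qed

lemma orient_acyclic:
  assumes "distinct p" "\<And>A. A \<in> E \<Longrightarrow> A \<subseteq> set p \<and> A \<noteq> {}"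
  shows "orient E p \<in> acyclic_orientations E"
proof -
  have "acyclic (arcs E (orient E p))"
    unfolding acyclic_def using poset_orient_subset[OF assms(1), of E] assms(2)
    by (auto simp: poset_def)
  moreover have "top_in p A \<in> A" if "A \<in> E" for A
    using top_in_mem(1)[of A p] assms(2)[OF that] by auto
  ultimately show ?thesis
    unfolding acyclic_orientations_def orient_def by auto
qed

text \<open>Either orientation may be the flip of the other; this builds in the symmetry that
  reading fibres in both directions requires.\<close>

definition flip_adjacent :: "nat \<Rightarrow> nat set set \<Rightarrow> (nat set \<Rightarrow> nat) \<Rightarrow> (nat set \<Rightarrow> nat) \<Rightarrow> bool" where
  "flip_adjacent n E h h' \<longleftrightarrow> h' \<noteq> h \<and>
     (\<exists>i\<in>{1..n}. \<exists>j\<in>{1..n}. i \<noteq> j \<and> (h' = pair_flip E i j h \<or> h = pair_flip E i j h'))"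

lemma flip_adjacent_sym: "flip_adjacent n E h h' \<Longrightarrow> flip_adjacent n E h' h"
  unfolding flip_adjacent_def by metis

lemma restrict_acyclic_orientations:
  assumes "h \<in> acyclic_orientations E" "E' \<subseteq> E"
  shows "restrict h E' \<in> acyclic_orientations E'"
proof -
  have "arcs E' (restrict h E') \<subseteq> arcs E h"
    using assms(2) by (auto simp: arcs_def)
  moreover have "restrict h E' \<in> (\<Pi>\<^sub>E A\<in>E'. A)"
    using assms unfolding acyclic_orientations_def by (auto simp: PiE_iff)
  ultimately show ?thesis
    using assms(1) unfolding acyclic_orientations_def by (auto intro: acyclic_subset)
qed

section \<open>One-vertex extensions of a chordal building set\<close>

locale chordal_extension =
  fixes m :: nat and E :: "nat set set"
  assumes chordal: "chordal_building_set (Suc m) E"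
begin

abbreviation "N \<equiv> Suc m"
abbreviation "E' \<equiv> restrict_edges E m"

lemma edge: "A \<in> E \<Longrightarrow> A \<subseteq> {1..N}" "A \<in> E \<Longrightarrow> A \<noteq> {}" "A \<in> E \<Longrightarrow> finite A"
  using chordal finite_subset[of A "{1..N}"]
  unfolding chordal_building_set_def building_set_def hypergraph_def by auto

lemma edge_union: "A \<in> E \<Longrightarrow> B \<in> E \<Longrightarrow> A \<inter> B \<noteq> {} \<Longrightarrow> A \<union> B \<in> E"
  using chordal unfolding chordal_building_set_def building_set_def by auto

lemma edge'_iff: "A \<in> E' \<longleftrightarrow> A \<in> E \<and> N \<notin> A"
proof -
  have "A \<subseteq> {1..m} \<longleftrightarrow> N \<notin> A" if "A \<in> E"
    using edge(1)[OF that] by (auto simp: subset_iff le_Suc_eq)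
  then show ?thesis unfolding restrict_edges_def by auto
qed

lemma edge'_subset: "A \<in> E' \<Longrightarrow> A \<subseteq> {1..m}"
  unfolding restrict_edges_def by auto

text \<open>\<open>N\<close> is the largest element of \<open>A\<close>, so \<open>A - {N}\<close>
  is the initial segment of \<open>A\<close> that omits only the last element, and chordality
  applies to it.\<close>

lemma edge_remove:
  assumes "A \<in> E" "N \<in> A" "A \<noteq> {N}"
  shows "A - {N} \<in> E'" "A - {N} \<subseteq> {1..m}" "A - {N} \<noteq> {}"
proof -
  have ne: "A - {N} \<noteq> {}" using assms by auto
  then show "A - {N} \<noteq> {}" .
  have sub: "A - {N} \<subseteq> {1..m}" using edge(1)[OF assms(1)] by (auto simp: subset_iff le_Suc_eq)
  then show "A - {N} \<subseteq> {1..m}" .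
  have fin: "finite (A - {N})" using edge(3)[OF assms(1)] by simp
  have "sorted_list_of_set A = sorted_list_of_set (A - {N}) @ [N]"
  proof (rule sorted_distinct_set_unique)
    show "sorted (sorted_list_of_set (A - {N}) @ [N])"
      using sub fin by (auto simp: sorted_append)
    show "set (sorted_list_of_set A) = set (sorted_list_of_set (A - {N}) @ [N])"
      using fin assms by auto
  qed (use fin in auto)
  then have "take (card (A - {N})) (sorted_list_of_set A) = sorted_list_of_set (A - {N})"
    by simp
  moreover have "card (A - {N}) \<in> {1..card A}"
    using ne fin edge(3)[OF assms(1)] by (auto simp: Suc_le_eq card_gt_0_iff intro: card_mono)
  ultimately have "set (sorted_list_of_set (A - {N})) \<in> E"
    using chordal assms(1) unfolding chordal_building_set_def by metis
  then show "A - {N} \<in> E'" using fin by (simp add: edge'_iff)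
qed

lemma chordal_restrict: "chordal_building_set m E'"
proof -
  have "set (take s (sorted_list_of_set A)) \<in> E'" if "A \<in> E'" "s \<in> {1..card A}" for A s
  proof -
    have A: "A \<in> E" "N \<notin> A" "finite A" using that edge(3) by (auto simp: edge'_iff)
    then have "set (take s (sorted_list_of_set A)) \<in> E"
      using that(2) chordal unfolding chordal_building_set_def by auto
    moreover have "N \<notin> set (take s (sorted_list_of_set A))"
      using A by (auto dest!: in_set_takeD)
    ultimately show ?thesis by (simp add: edge'_iff)
  qed
  moreover have "{v} \<in> E'" if "v \<in> {1..m}" for v
    using that chordal unfolding edge'_iff chordal_building_set_def building_set_def by auto
  ultimately show ?thesis
    unfolding chordal_building_set_def building_set_def hypergraph_def
    using edge(2) edge_union edge'_subset by (auto simp: edge'_iff)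
qed

definition heads :: "nat list \<Rightarrow> nat set" where
  "heads q = {top_in q (A - {N}) | A. A \<in> E \<and> N \<in> A \<and> A \<noteq> {N}}"

text \<open>If \<open>q\<close> encodes an orientation of \<open>E'\<close>, then its extensions to \<open>E\<close> are encoded by inserting
  \<open>N\<close> behind the first \<open>k\<close> letters of \<open>q\<close> for the slots \<open>k\<close>. The possible upper covers of \<open>N\<close> are the
  heads; they form a chain, and \<open>N\<close> is covered by \<open>q ! k\<close> unless it is maximal or minimal. The first head
  gives no slot of its own, as \<open>N\<close> is then minimal and goes to the front.\<close>

definition slot :: "nat list \<Rightarrow> nat \<Rightarrow> bool" where
  "slot q k \<longleftrightarrow> k = m \<or> k = 0 \<and> heads q \<noteq> {} \<or>
     0 < k \<and> k < m \<and> q ! k \<in> heads q \<and> (\<exists>j<k. q ! j \<in> heads q)"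

lemma slot_le: "slot q k \<Longrightarrow> k \<le> m"
  unfolding slot_def by auto

end

locale chordal_extension_word = chordal_extension +
  fixes q :: "nat list"
  assumes q: "distinct q" "set q = {1..m}"
begin

lemma q_length: "length q = m"
  using distinct_card[OF q(1)] q(2) by simp

lemma N_notin: "N \<notin> set q"
  using q by simp

lemma head_mem:
  assumes "A \<in> E" "N \<in> A" "A \<noteq> {N}"
  shows "top_in q (A - {N}) \<in> A" "top_in q (A - {N}) \<in> {1..m}" "top_in q (A - {N}) \<in> heads q"
proof -
  have "(A - {N}) \<inter> set q \<noteq> {}" using edge_remove[OF assms] q by auto
  from top_in_mem[OF this] show "top_in q (A - {N}) \<in> A" "top_in q (A - {N}) \<in> {1..m}"
    using q by auto
  show "top_in q (A - {N}) \<in> heads q" using assms by (auto simp: heads_def)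
qed

lemma heads_subset: "heads q \<subseteq> {1..m}"
proof
  fix s assume "s \<in> heads q"
  then obtain A where "A \<in> E" "N \<in> A" "A \<noteq> {N}" "s = top_in q (A - {N})"
    unfolding heads_def by blast
  then show "s \<in> {1..m}" using head_mem(2)[of A] by blast
qed

text \<open>The two hyperedges share \<open>N\<close>, so closure under unions applies. Inside
  \<open>A \<union> B - {N}\<close> the earlier head, if distinct, has an arc to the later one,
  which makes the heads a chain.\<close>

lemma head_union:
  assumes A: "A \<in> E" "N \<in> A" "A \<noteq> {N}" and B: "B \<in> E" "N \<in> B" "B \<noteq> {N}"
    and le: "position q (top_in q (A - {N})) \<le> position q (top_in q (B - {N}))"
  shows "A \<union> B \<in> E" "top_in q (A \<union> B - {N}) = top_in q (B - {N})"
proof -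
  show "A \<union> B \<in> E" using edge_union A B by auto
  show "top_in q (A \<union> B - {N}) = top_in q (B - {N})"
  proof (rule top_in_eqI[OF q(1)])
    fix x assume x: "x \<in> A \<union> B - {N}" "x \<in> set q"
    then consider "x \<in> A - {N}" | "x \<in> B - {N}" by auto
    then show "position q x \<le> position q (top_in q (B - {N}))"
    proof cases
      case 1
      then show ?thesis using position_le_top_in[OF q(1) 1 x(2)] le by linarith
    next
      case 2
      then show ?thesis using position_le_top_in[OF q(1) 2 x(2)] by simp
    qed
  qed (use head_mem[OF B] q in auto)
qed

lemma orient_ins:
  assumes "A \<in> E"
  shows "N \<notin> A \<Longrightarrow> orient E (ins k N q) A = top_in q A"
    and "A = {N} \<Longrightarrow> orient E (ins k N q) A = N"
    and "N \<in> A \<Longrightarrow> A \<noteq> {N} \<Longrightarrow> orient E (ins k N q) A =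
      (if k < position q (top_in q (A - {N})) then top_in q (A - {N}) else N)"
proof -
  show "N \<notin> A \<Longrightarrow> orient E (ins k N q) A = top_in q A"
    using top_in_ins(1)[OF N_notin] assms by (simp add: orient_def)
  show "A = {N} \<Longrightarrow> orient E (ins k N q) A = N"
    using top_in_ins(3)[OF N_notin, of A k] assms by (simp add: orient_def)
  show "orient E (ins k N q) A =
      (if k < position q (top_in q (A - {N})) then top_in q (A - {N}) else N)"
    if A: "N \<in> A" "A \<noteq> {N}"
  proof -
    have "(A - {N}) \<inter> set q \<noteq> {}" using edge_remove[OF assms A] q by auto
    from top_in_ins(2)[OF N_notin A(1) q(1) this] show ?thesis using assms by (simp add: orient_def)
  qed
qed

lemma ins_word: "distinct (ins k N q)" "set (ins k N q) = {1..N}"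
  using q by auto

lemma orient_ins_acyclic: "orient E (ins k N q) \<in> acyclic_orientations E"
  using ins_word edge by (intro orient_acyclic) auto

lemma restrict_orient_ins: "restrict (orient E (ins k N q)) E' = orient E' q"
proof
  fix A show "restrict (orient E (ins k N q)) E' A = orient E' q A"
  proof (cases "A \<in> E'")
    case True
    then show ?thesis using orient_ins(1)[of A k] by (simp add: edge'_iff orient_def)
  qed (simp add: orient_def)
qed

text \<open>The three kinds of slots match the cases of \<open>perm_of\<close>: at the end
  \<open>N\<close> is maximal, at the front it is minimal but not maximal, and otherwise an earlier
  head lies below \<open>N\<close> while \<open>q ! k\<close> is its unique cover.\<close>

lemma perm_of_orient_ins:
  assumes k: "slot q k" and IH: "perm_of m E' (orient E' q) = q"
  shows "perm_of N E (orient E (ins k N q)) = ins k N q"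
proof -
  define h where "h = orient E (ins k N q)"
  define P where "P = poset E h"
  have perm: "perm_of N E h =
     (if \<not> (\<exists>j. (N, j) \<in> P) then insert_at N N q
      else if \<not> (\<exists>i. (i, N) \<in> P) then insert_at 1 N q
      else insert_at (position q (THE j. covers P j N)) N q)"
    using IH by (simp add: restrict_orient_ins h_def P_def Let_def)
  have insert_at: "insert_at (Suc i) N q = ins i N q" for i
    by (simp add: insert_at_def ins_def)
  have k_le: "k \<le> length q" using slot_le[OF k] q_length by simp
  have P: "(x, y) \<in> P \<Longrightarrow> position (ins k N q) x < position (ins k N q) y" for x y
    using poset_orient_subset[OF ins_word(1), of E k] ins_word(2) edge unfolding P_def h_def by auto
  have h: "h A = (if k < position q (top_in q (A - {N})) then top_in q (A - {N}) else N)"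
    if "A \<in> E" "N \<in> A" "A \<noteq> {N}" for A
    using orient_ins(3)[OF that] by (simp add: h_def)
  have arc_out: "\<exists>A. A \<in> E \<and> N \<in> A \<and> A \<noteq> {N} \<and> y = top_in q (A - {N}) \<and> k < position q y"
    if Ny: "(N, y) \<in> arcs E h" for y
  proof -
    obtain A where A: "A \<in> E" "N \<in> A" "y \<in> A" "y = h A" "y \<noteq> N" using Ny by (auto simp: arcs_def)
    then have "A \<noteq> {N}" by auto
    then show ?thesis using h[of A] A by (auto split: if_splits)
  qed
  have no_arc_to_arc: "(x, N) \<in> P \<Longrightarrow> \<exists>y. (y, N) \<in> arcs E h" for x
    unfolding P_def poset_def by (metis tranclD2)
  have no_arc_from_arc: "(N, x) \<in> P \<Longrightarrow> \<exists>y. (N, y) \<in> arcs E h" for x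
    unfolding P_def poset_def by (metis tranclD)
  have arc_P: "(x, y) \<in> arcs E h \<Longrightarrow> (x, y) \<in> P" for x y
    unfolding P_def poset_def by auto
  from k consider "k = m" | "k = 0" "heads q \<noteq> {}" "m \<noteq> 0"
    | "0 < k" "k < m" "q ! k \<in> heads q" "\<exists>j<k. q ! j \<in> heads q"
    unfolding slot_def by auto
  then show ?thesis
  proof cases
    case 1
    \<comment> \<open>An arc out of \<open>N\<close> would need a head at a position beyond
      \<open>m\<close>.\<close>
    have "\<not> (N, y) \<in> arcs E h" for y
    proof
      assume "(N, y) \<in> arcs E h"
      from arc_out[OF this] obtain A where "A \<in> E" "N \<in> A" "A \<noteq> {N}"
        "y = top_in q (A - {N})" "k < position q y" by blast
      then show False using position_le[of y q] head_mem[of A] q q_length 1 by auto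
    qed
    then have "\<not> (\<exists>j. (N, j) \<in> P)" using no_arc_from_arc by blast
    then show ?thesis using perm insert_at[of m] 1 by (simp add: h_def)
  next
    case 2
    have pos: "0 < position q x" for x by (simp add: position_def)
    obtain A where A: "A \<in> E" "N \<in> A" "A \<noteq> {N}" using 2 by (auto simp: heads_def)
    have "h A = top_in q (A - {N})" using h[OF A] 2 pos by simp
    moreover from this have "h A \<noteq> N" using head_mem(2)[OF A] by auto
    ultimately have "(N, h A) \<in> arcs E h" using A head_mem(1)[OF A] by (intro arcsI) auto
    then have "\<exists>j. (N, j) \<in> P" using arc_P by blast
    \<comment> \<open>A hyperedge other than \<open>{N}\<close> pointing to \<open>N\<close> would
      have its head at position at most \<open>k = 0\<close>, but positions start at 1.\<close>
    moreover have "\<not> (y, N) \<in> arcs E h" for y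
    proof
      assume "(y, N) \<in> arcs E h"
      then obtain B where B: "B \<in> E" "N \<in> B" "y \<in> B" "h B = N" "y \<noteq> N" by (auto simp: arcs_def)
      then have "B \<noteq> {N}" by blast
      then show False using h[OF B(1,2)] head_mem(2)[OF B(1,2)] B(4) pos 2 by simp
    qed
    then have "\<not> (\<exists>i. (i, N) \<in> P)" using no_arc_to_arc by blast
    ultimately show ?thesis using perm insert_at[of 0] 2 by (simp add: h_def)
  next
    case 3
    define c where "c = q ! k"
    have pos_c: "position q c = Suc k" using position_nth[OF q(1), of k] 3 q_length by (simp add: c_def)
    have c_in: "c \<in> set q" using 3 q_length by (simp add: c_def)
    obtain C where C: "C \<in> E" "N \<in> C" "C \<noteq> {N}" "c = top_in q (C - {N})"
      using 3 by (auto simp: heads_def c_def)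
    have "h C = c" using h[OF C(1-3)] pos_c C(4) by simp
    moreover have "N \<noteq> c" using c_in N_notin by blast
    ultimately have "(N, c) \<in> arcs E h"
      using arcsI[of C E N h] C head_mem(1)[OF C(1-3)] by simp
    then have Nc: "(N, c) \<in> P" by (rule arc_P)
    obtain j where j: "j < k" "q ! j \<in> heads q" using 3 by auto
    then obtain B where B: "B \<in> E" "N \<in> B" "B \<noteq> {N}" "q ! j = top_in q (B - {N})"
      by (auto simp: heads_def)
    have "position q (q ! j) = Suc j" using position_nth[OF q(1), of j] 3 j q_length by simp
    then have "h B = N" using h[OF B(1-3)] B(4) j by simp
    moreover have "q ! j \<noteq> N" using B(4) head_mem(2)[OF B(1-3)] by auto
    ultimately have "(q ! j, N) \<in> arcs E h"
      using arcsI[of B E "q ! j" h] B head_mem(1)[OF B(1-3)] by simp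
    then have "(q ! j, N) \<in> P" by (rule arc_P)
    \<comment> \<open>Every arc out of \<open>N\<close> ends in a head \<open>s\<close> not before
      \<open>c\<close>. The union of the two hyperedges also points to \<open>s\<close>, which gives
      an arc from \<open>c\<close> to \<open>s\<close> unless they coincide; hence \<open>c\<close>
      lies weakly below everything above \<open>N\<close>.\<close>
    have between: "c = y \<or> (c, y) \<in> P" if Ny: "(N, y) \<in> P" for y
    proof -
      have chain: "c = s \<or> (c, s) \<in> arcs E h" if s: "(N, s) \<in> arcs E h" for s
      proof -
        obtain A where A: "A \<in> E" "N \<in> A" "A \<noteq> {N}" "s = top_in q (A - {N})" "k < position q s"
          using arc_out[OF s] by blast
        have le: "position q (top_in q (C - {N})) \<le> position q (top_in q (A - {N}))"
          using pos_c C(4) A(4,5) by simp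
        have "C \<union> A \<noteq> {N}" using C(2,3) by blast
        then have "h (C \<union> A) = s"
          using h[of "C \<union> A"] head_union[OF C(1-3) A(1-3) le] A(4,5) C(2) by simp
        then show ?thesis
          using arcsI[of "C \<union> A" E c h] head_union(1)[OF C(1-3) A(1-3) le] C(4) head_mem(1)[OF C(1-3)]
            A(4) head_mem(1)[OF A(1-3)] by auto
      qed
      obtain s where s: "(N, s) \<in> arcs E h" "s = y \<or> (s, y) \<in> P"
        using Ny unfolding P_def poset_def by (metis rtranclD tranclD)
      then have "c = s \<or> (c, s) \<in> P" using chain arc_P by blast
      then show ?thesis using s(2) unfolding P_def poset_def by (metis trancl_trans)
    qed
    have P_trans: "(x, y) \<in> P \<Longrightarrow> (y, z) \<in> P \<Longrightarrow> (x, z) \<in> P" for x y z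
      unfolding P_def poset_def by (rule trancl_trans)
    have P_irrefl: "(x, x) \<notin> P" for x using P[of x x] by auto
    have "covers P c N"
      unfolding covers_def using Nc between P_trans P_irrefl by metis
    moreover have "y = c" if "covers P y N" for y
      using that Nc between[of y] unfolding covers_def by auto
    ultimately have "(THE j. covers P j N) = c" by (rule the_equality)
    \<comment> \<open>\<open>insert_at\<close> with the position \<open>Suc k\<close> of
      \<open>c\<close> puts \<open>N\<close> directly before \<open>c\<close>; the head
      \<open>q ! j\<close> below \<open>N\<close> excludes the case of minimality.\<close>
    then show ?thesis
      using perm insert_at[of k] pos_c Nc \<open>(q ! j, N) \<in> P\<close> by (auto simp: h_def)
  qed
qed

text \<open>Whether a hyperedge \<open>A\<close> points to \<open>N\<close> depends monotonically on
  the position of the head of \<open>A - {N}\<close>, so a single threshold describes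
  \<open>h\<close>, and this threshold yields the slot.\<close>

lemma orientation_extends:
  assumes h: "h \<in> acyclic_orientations E" and res: "restrict h E' = orient E' q"
  obtains k where "slot q k" "h = orient E (ins k N q)"
proof -
  have hA: "h A \<in> A" if "A \<in> E" for A
    using h that by (auto simp: acyclic_orientations_def)
  have acyc: "acyclic (arcs E h)" using h by (simp add: acyclic_orientations_def)
  have no2: "\<not> ((x, y) \<in> arcs E h \<and> (y, x) \<in> arcs E h)" for x y
    using acyc unfolding acyclic_def by (meson r_into_trancl' trancl_into_trancl)
  have arc: "x = h A \<or> (x, h A) \<in> arcs E h" if "A \<in> E" "x \<in> A" for x A
    using that hA[OF that(1)] by (auto simp: arcs_def)
  have h': "h A = top_in q A" if "A \<in> E" "N \<notin> A" for A
    using fun_cong[OF res, of A] that by (simp add: edge'_iff orient_def)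
  \<comment> \<open>A third head of \<open>A\<close> would lie in \<open>A - {N}\<close>, and the
    two hyperedges would yield opposite arcs between their heads.\<close>
  have h_cases: "h A = N \<or> h A = top_in q (A - {N})" if A: "A \<in> E" "N \<in> A" "A \<noteq> {N}" for A
  proof (rule ccontr)
    assume *: "\<not> ?thesis"
    have B: "A - {N} \<in> E" "N \<notin> A - {N}" using edge_remove(1)[OF A] by (auto simp: edge'_iff)
    have "h A \<in> A - {N}" using hA[OF A(1)] * by auto
    then have "(h A, h (A - {N})) \<in> arcs E h" using arc[OF B(1), of "h A"] h'[OF B] * by auto
    moreover have "(h (A - {N}), h A) \<in> arcs E h"
      using arc[OF A(1), of "h (A - {N})"] hA[OF B(1)] h'[OF B] * by auto
    ultimately show False using no2 by blast
  qed
  \<comment> \<open>If \<open>h A\<close> were not \<open>N\<close>, then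
    \<open>A \<union> B\<close> could point neither to \<open>N\<close>, because of
    \<open>A\<close>, nor to the head of \<open>B - {N}\<close>, because of
    \<open>B\<close>.\<close>
  have mono: "h A = N" if A: "A \<in> E" "N \<in> A" "A \<noteq> {N}" and B: "B \<in> E" "N \<in> B" "B \<noteq> {N}"
    and le: "position q (top_in q (A - {N})) \<le> position q (top_in q (B - {N}))" and "h B = N" for A B
  proof (rule ccontr)
    assume *: "h A \<noteq> N"
    then have hA': "h A = top_in q (A - {N})" using h_cases[OF A] by auto
    have NA: "(N, h A) \<in> arcs E h" using arc[OF A(1,2)] * by auto
    note U = head_union[OF A B le]
    have "h (A \<union> B) = N \<or> h (A \<union> B) = top_in q (B - {N})"
      using h_cases[of "A \<union> B"] U A by auto
    then show False
    proof
      assume "h (A \<union> B) = N"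
      then have "(h A, N) \<in> arcs E h" using arc[OF U(1), of "h A"] hA[OF A(1)] * by auto
      then show False using NA no2 by blast
    next
      assume **: "h (A \<union> B) = top_in q (B - {N})"
      have "top_in q (B - {N}) \<noteq> N" using head_mem[OF B] by auto
      then have "(N, top_in q (B - {N})) \<in> arcs E h" "(top_in q (B - {N}), N) \<in> arcs E h"
        using arc[OF U(1), of N] arc[OF B(1), of "top_in q (B - {N})"] ** A head_mem[OF B] \<open>h B = N\<close>
        by auto
      then show False using no2 by blast
    qed
  qed
  have eqI: "h = orient E (ins k N q)"
    if *: "\<And>A. A \<in> E \<Longrightarrow> N \<in> A \<Longrightarrow> A \<noteq> {N} \<Longrightarrow> h A = N \<longleftrightarrow> position q (top_in q (A - {N})) \<le> k" for k
  proof
    fix A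
    consider "A \<notin> E" | "A \<in> E" "N \<notin> A" | "A \<in> E" "A = {N}" | "A \<in> E" "N \<in> A" "A \<noteq> {N}" by auto
    then show "h A = orient E (ins k N q) A"
    proof cases
      case 1
      then have "h A = undefined" using h PiE_arb[of h E "\<lambda>A. A" A] by (simp add: acyclic_orientations_def)
      then show ?thesis using 1 by (simp add: orient_def)
    next
      case 2
      then show ?thesis using h' orient_ins(1) by simp
    next
      case 3
      then show ?thesis using hA[OF 3(1)] orient_ins(2) by simp
    next
      case 4
      then show ?thesis using h_cases[OF 4] *[OF 4] orient_ins(3)[OF 4, of k] by auto
    qed
  qed
  \<comment> \<open>If \<open>U\<close> is empty, \<open>N\<close> goes to the end. Otherwise its
    earliest element \<open>s\<close> is the threshold: \<open>N\<close> goes directly before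
    \<open>s\<close> if some hyperedge other than \<open>{N}\<close> points to \<open>N\<close>, and
    to the front if none does.\<close>
  define U where "U = {s. \<exists>A. A \<in> E \<and> N \<in> A \<and> A \<noteq> {N} \<and> s = top_in q (A - {N}) \<and> h A \<noteq> N}"
  have U: "U \<subseteq> heads q" by (auto simp: U_def heads_def)
  show ?thesis
  proof (cases "U = {}")
    case True
    have "position q (top_in q (A - {N})) \<le> m" if "A \<in> E" "N \<in> A" "A \<noteq> {N}" for A
      using position_le[of "top_in q (A - {N})" q] head_mem[OF that] q q_length by simp
    moreover have "slot q m" by (simp add: slot_def)
    ultimately show ?thesis using that[of m] eqI[of m] True by (auto simp: U_def)
  next
    case False
    obtain s where s: "s \<in> U" "\<And>t. t \<in> U \<Longrightarrow> position q s \<le> position q t"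
      using arg_min_nat_lemma[of "\<lambda>s. s \<in> U" _ "position q"] False by blast
    have s_q: "s \<in> set q" using s(1) U heads_subset q by auto
    obtain C where C: "C \<in> E" "N \<in> C" "C \<noteq> {N}" "s = top_in q (C - {N})" "h C \<noteq> N"
      using s(1) by (auto simp: U_def)
    have iff: "h A = N \<longleftrightarrow> position q (top_in q (A - {N})) < position q s"
      if A: "A \<in> E" "N \<in> A" "A \<noteq> {N}" for A
    proof
      assume "h A = N"
      then show "position q (top_in q (A - {N})) < position q s"
        using mono[OF C(1-3) A] C(4,5) by force
    next
      assume *: "position q (top_in q (A - {N})) < position q s"
      show "h A = N"
      proof (rule ccontr)
        assume "h A \<noteq> N"
        then have "top_in q (A - {N}) \<in> U" using A by (auto simp: U_def)
        then show False using s(2) * by force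
      qed
    qed
    show ?thesis
    proof (cases "\<exists>A. A \<in> E \<and> N \<in> A \<and> A \<noteq> {N} \<and> h A = N")
      case True
      then obtain A where A: "A \<in> E" "N \<in> A" "A \<noteq> {N}" "h A = N" by blast
      define k where "k = position q s - 1"
      obtain i where i: "i < m" "q ! i = s" using s_q q_length by (metis in_set_conv_nth)
      then have ki: "position q s = Suc i" "k = i"
        using position_nth[OF q(1), of i] q_length by (auto simp: k_def)
      obtain j where j: "j < m" "q ! j = top_in q (A - {N})"
        using head_mem[OF A(1-3)] q q_length by (metis in_set_conv_nth)
      then have "position q (top_in q (A - {N})) = Suc j"
        using position_nth[OF q(1), of j] q_length by simp
      then have "j < k" using iff[OF A(1-3)] A(4) ki by simp
      moreover have "q ! j \<in> heads q" using j A by (auto simp: heads_def)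
      ultimately have "slot q k" unfolding slot_def using ki i s(1) U by auto
      moreover have "h = orient E (ins k N q)" using iff ki by (intro eqI) auto
      ultimately show ?thesis using that by blast
    next
      case no: False
      have "slot q 0" using s(1) U by (auto simp: slot_def)
      moreover have "h = orient E (ins 0 N q)"
        using no by (intro eqI) (auto simp: position_def)
      ultimately show ?thesis using that by blast
    qed
  qed
qed

text \<open>Exactly one head \<open>s\<close> stands between the two slots. Moving \<open>N\<close>
  across it redirects from \<open>s\<close> to \<open>N\<close> the hyperedges for which
  \<open>A - {N}\<close> has head \<open>s\<close>, and no other ones.\<close>

lemma flip_consecutive_slots:
  assumes i: "slot q i" "slot q i'" "i < i'" "\<And>k. slot q k \<Longrightarrow> \<not> (i < k \<and> k < i')"
  shows "flip_adjacent N E (orient E (ins i N q)) (orient E (ins i' N q))"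
proof -
  let ?h = "orient E (ins i N q)" and ?h' = "orient E (ins i' N q)"
  have i'm: "i' \<le> m" using slot_le[OF i(2)] .
  \<comment> \<open>The letter \<open>q ! i\<close> is a head except possibly for
    \<open>i = 0\<close>. In that case the second slot requires a head before it or, if it is the
    end, any head will do.\<close>
  obtain a where a: "i \<le> a" "a < i'" "q ! a \<in> heads q"
  proof (cases "q ! i \<in> heads q")
    case True
    then show ?thesis using i(3) that by blast
  next
    case False
    then have i0: "i = 0" "heads q \<noteq> {}" using i i'm unfolding slot_def by auto
    show ?thesis
    proof (cases "i' = m")
      case True
      obtain s where s: "s \<in> heads q" using i0 by auto
      then obtain a where "a < m" "q ! a = s"
        using heads_subset q q_length by (metis in_set_conv_nth subsetD)
      then show ?thesis using that[of a] i0 True s by auto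
    next
      case False
      then show ?thesis using that i(2,3) i0 unfolding slot_def by auto
    qed
  qed
  define s where "s = q ! a"
  have pos_s: "position q s = Suc a" using position_nth[OF q(1), of a] a i'm q_length by (simp add: s_def)
  have s: "s \<in> {1..m}" using a heads_subset by (auto simp: s_def)
  \<comment> \<open>Of two distinct heads in the gap, the later one would itself be a slot strictly
    between \<open>i\<close> and \<open>i'\<close>.\<close>
  have unique: "t = s" if t: "t \<in> heads q" "i < position q t" "position q t \<le> i'" for t
  proof -
    obtain b where b: "b < m" "q ! b = t" using t(1) heads_subset q q_length
      by (metis in_set_conv_nth subsetD)
    then have pos_t: "position q t = Suc b" using position_nth[OF q(1), of b] q_length by simp
    have "\<not> a < b"
    proof
      assume "a < b"
      then have "slot q b" unfolding slot_def using b t(1) a by auto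
      then show False using i(4)[of b] \<open>a < b\<close> a(1) t(3) pos_t by auto
    qed
    moreover have "\<not> b < a"
    proof
      assume "b < a"
      then have "slot q a" unfolding slot_def using b t(1) a i'm by auto
      then show False using i(4)[of a] \<open>b < a\<close> a t(2) pos_t by auto
    qed
    ultimately have "a = b" by simp
    then show ?thesis using b by (simp add: s_def)
  qed
  have "?h' = pair_flip E N s ?h"
  proof
    fix A
    consider "A \<notin> E" | "A \<in> E" "N \<notin> A" | "A \<in> E" "A = {N}" | "A \<in> E" "N \<in> A" "A \<noteq> {N}" by auto
    then show "?h' A = pair_flip E N s ?h A"
    proof cases
      case 1
      then show ?thesis by (simp add: orient_def pair_flip_def)
    next
      case 2
      then show ?thesis using orient_ins(1) by (simp add: pair_flip_def)
    next
      case 3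
      then show ?thesis using orient_ins(2) by (simp add: pair_flip_def)
    next
      case 4
      let ?t = "top_in q (A - {N})"
      have t: "?t \<in> heads q" "?t \<noteq> N" using head_mem[OF 4] by auto
      have hs: "?h A = (if i < position q ?t then ?t else N)" "?h' A = (if i' < position q ?t then ?t else N)"
        using orient_ins(3)[OF 4] by auto
      have flip: "pair_flip E N s ?h A = (if ?h A = s then N else ?h A)"
        using 4 by (simp add: pair_flip_def)
      consider "position q ?t \<le> i" | "i < position q ?t" "position q ?t \<le> i'" | "i' < position q ?t"
        by linarith
      then show ?thesis
      proof cases
        case 1
        then show ?thesis using flip hs i(3) s by simp
      next
        case 2
        then show ?thesis using flip hs unique[OF t(1)] by simp
      next
        case 3
        then have "?t \<noteq> s" using pos_s a by auto
        then show ?thesis using flip hs 3 i(3) by simp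
      qed
    qed
  qed
  moreover have "?h' \<noteq> ?h"
  proof -
    obtain A where A: "A \<in> E" "N \<in> A" "A \<noteq> {N}" "s = top_in q (A - {N})"
      using a(3) by (auto simp: s_def heads_def)
    then have "?h A = s" "?h' A = N"
      using orient_ins(3)[OF A(1-3), of i] orient_ins(3)[OF A(1-3), of i'] pos_s a by auto
    then show ?thesis using s by auto
  qed
  moreover have "N \<in> {1..N}" "s \<in> {1..N}" "N \<noteq> s" using s by auto
  ultimately show ?thesis unfolding flip_adjacent_def by blast
qed

end

section \<open>Assembling the fibres by induction on the number of vertices\<close>

lemma successively_gapless:
  fixes xs :: "'a::linorder list"
  assumes "sorted_wrt (<) xs"
  shows "successively (\<lambda>a b. a < b \<and> (\<forall>c\<in>set xs. \<not> (a < c \<and> c < b))) xs"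
  unfolding successively_conv_nth
proof (intro allI impI conjI ballI)
  fix i assume i: "Suc i < length xs"
  then show "xs ! i < xs ! Suc i" using assms by (simp add: sorted_wrt_iff_nth_less)
  fix c assume "c \<in> set xs"
  then obtain k where k: "k < length xs" "c = xs ! k" by (metis in_set_conv_nth)
  have "xs ! a < xs ! b \<longleftrightarrow> a < b" if "a < length xs" "b < length xs" for a b
    using assms that by (metis linorder_neqE_nat order_less_asym order_less_irrefl sorted_wrt_iff_nth_less)
  then show "\<not> (xs ! i < c \<and> c < xs ! Suc i)" using i k by simp
qed

context chordal_extension
begin

text \<open>With \<open>N\<close> in front, a hyperedge \<open>A\<close> containing
  \<open>N\<close>, other than \<open>{N}\<close>, has the same head as \<open>A - {N}\<close> and
  takes part in the flip exactly when \<open>A - {N}\<close> does. With \<open>N\<close> at the end,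
  all hyperedges containing \<open>N\<close> point to \<open>N\<close> before and after.\<close>

lemma flip_adjacent_ins_end:
  assumes p: "distinct p" "set p = {1..m}" and q: "distinct q" "set q = {1..m}"
    and flip: "flip_adjacent m E' (orient E' p) (orient E' q)" and e: "e = 0 \<or> e = m"
  shows "flip_adjacent N E (orient E (ins e N p)) (orient E (ins e N q))"
proof -
  interpret p: chordal_extension_word m E p using p by unfold_locales
  interpret q: chordal_extension_word m E q using q by unfold_locales
  have lift: "orient E (ins e N w') = pair_flip E i j (orient E (ins e N w))"
    if w: "chordal_extension_word m E w" "chordal_extension_word m E w'" and ij: "i \<in> {1..m}" "j \<in> {1..m}"
      and eq: "orient E' w' = pair_flip E' i j (orient E' w)" for i j w w'
  proof
    fix A
    have top: "top_in w' B = (if top_in w B = j \<and> i \<in> B then i else top_in w B)" if "B \<in> E'" for B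
      using fun_cong[OF eq, of B] that by (simp add: orient_def pair_flip_def)
    consider "A \<notin> E" | "A \<in> E" "N \<notin> A" | "A \<in> E" "A = {N}" | "A \<in> E" "N \<in> A" "A \<noteq> {N}" by auto
    then show "orient E (ins e N w') A = pair_flip E i j (orient E (ins e N w)) A"
    proof cases
      case 1
      then show ?thesis by (simp add: orient_def pair_flip_def)
    next
      case 2
      then have "A \<in> E'" by (simp add: edge'_iff)
      then show ?thesis using top[of A] 2 chordal_extension_word.orient_ins(1)[OF w(1) 2, of e]
        chordal_extension_word.orient_ins(1)[OF w(2) 2, of e]
        by (simp add: pair_flip_def)
    next
      case 3
      then show ?thesis using ij chordal_extension_word.orient_ins(2)[OF w(1) 3, of e]
        chordal_extension_word.orient_ins(2)[OF w(2) 3, of e] by (simp add: pair_flip_def)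
    next
      case 4
      note h = chordal_extension_word.orient_ins(3)[OF w(1) 4, of e]
        chordal_extension_word.orient_ins(3)[OF w(2) 4, of e]
      from e show ?thesis
      proof
        assume "e = 0"
        then have "orient E (ins e N w) A = top_in w (A - {N})" "orient E (ins e N w') A = top_in w' (A - {N})"
          using h by (simp_all add: position_def)
        then show ?thesis using top[OF edge_remove(1)[OF 4]] 4 ij by (simp add: pair_flip_def)
      next
        assume "e = m"
        moreover have "position w (top_in w (A - {N})) \<le> m" "position w' (top_in w' (A - {N})) \<le> m"
          using chordal_extension_word.head_mem(2)[OF w(1) 4] chordal_extension_word.head_mem(2)[OF w(2) 4]
            position_le chordal_extension_word.q[OF w(1)] chordal_extension_word.q[OF w(2)]
            chordal_extension_word.q_length[OF w(1)] chordal_extension_word.q_length[OF w(2)]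
          by metis+
        ultimately have "orient E (ins e N w) A = N" "orient E (ins e N w') A = N"
          using h by simp_all
        then show ?thesis using 4 ij by (simp add: pair_flip_def)
      qed
    qed
  qed
  obtain i j where ij: "i \<in> {1..m}" "j \<in> {1..m}" "i \<noteq> j" and
    "orient E' q = pair_flip E' i j (orient E' p) \<or> orient E' p = pair_flip E' i j (orient E' q)"
    using flip unfolding flip_adjacent_def by blast
  then have "orient E (ins e N q) = pair_flip E i j (orient E (ins e N p)) \<or>
      orient E (ins e N p) = pair_flip E i j (orient E (ins e N q))"
    using lift[OF p.chordal_extension_word_axioms q.chordal_extension_word_axioms ij(1,2)]
      lift[OF q.chordal_extension_word_axioms p.chordal_extension_word_axioms ij(1,2)] by blast
  moreover have "orient E (ins e N q) \<noteq> orient E (ins e N p)"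
    using flip p.restrict_orient_ins[of e] q.restrict_orient_ins[of e]
    unfolding flip_adjacent_def by metis
  moreover have "i \<in> {1..N}" "j \<in> {1..N}" using ij by auto
  ultimately show ?thesis using ij(3) unfolding flip_adjacent_def by blast
qed

end

text \<open>The induction also carries that each word is recovered from its orientation, which feeds
  \<open>perm_of_orient_ins\<close>, and that all acyclic orientations occur, which feeds the
  surjectivity by \<open>orientation_extends\<close>. Together they identify \<open>set ps\<close>
  with the input of Algorithm J.\<close>

lemma chordal_sequence:
  assumes "chordal_building_set n E"
  shows "\<exists>ps. J_sequence (set ps) ps \<and> distinct ps \<and> hd ps = [1..<Suc n] \<and>
    (\<forall>p\<in>set ps. distinct p \<and> set p = {1..n} \<and> perm_of n E (orient E p) = p) \<and>
    orient E ` set ps = acyclic_orientations E \<and>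
    successively (\<lambda>p p'. flip_adjacent n E (orient E p) (orient E p')) ps"
  using assms
proof (induction n arbitrary: E)
  case 0
  \<comment> \<open>Without vertices there is no hyperedge and only one orientation, undefined
    everywhere, which is encoded by the empty word.\<close>
  then have E: "E = {}" unfolding chordal_building_set_def building_set_def hypergraph_def by auto
  have "J_sequence {[]} [[]]"
  proof -
    have "\<not> J_step {[]} [[]] q" for q
      using jump_mem[of _ _ _ "[]"]
      unfolding J_step_def jump_to_new_def minimal_jump_def by fastforce
    then show ?thesis unfolding J_sequence_def by (auto simp: append_eq_Cons_conv Cons_eq_append_conv)
  qed
  moreover have "acyclic_orientations {} = {\<lambda>_. undefined}"
    by (auto simp: acyclic_orientations_def arcs_def acyclic_def)
  ultimately show ?case
    by (intro exI[of _ "[[]]"]) (auto simp: E orient_def)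
next
  case (Suc m)
  interpret chordal_extension m E using Suc.prems by unfold_locales
  obtain qs where J: "J_sequence (set qs) qs" and dist: "distinct qs" and hd: "hd qs = [1..<Suc m]"
    and qs: "\<And>q. q \<in> set qs \<Longrightarrow> distinct q \<and> set q = {1..m} \<and> perm_of m E' (orient E' q) = q"
    and AO: "orient E' ` set qs = acyclic_orientations E'"
    and flips: "successively (\<lambda>p p'. flip_adjacent m E' (orient E' p) (orient E' p')) qs"
    using Suc.IH[OF chordal_restrict] by metis
  define P where "P = (\<lambda>q. filter (slot q) [0..<Suc m])"
  define f where "f = (\<lambda>q. map (\<lambda>i. ins i N q) (P q))"
  \<comment> \<open>Whether \<open>heads q\<close> is empty does not depend on \<open>q\<close>, so
    all fibres have the same first slot.\<close>
  define z where "z = (if \<exists>A\<in>E. N \<in> A \<and> A \<noteq> {N} then 0 else m)"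
  \<comment> \<open>The first fibre is read backwards, so the run starts with \<open>N\<close>
    behind the identity word on \<open>m\<close> letters.\<close>
  define ps where "ps = zigzag True f qs"
  have word: "chordal_extension_word m E q" if "q \<in> set qs" for q
    using qs[OF that] by unfold_locales auto
  have P_set: "set (P q) = {i. slot q i}" for q
    using slot_le[of q] by (auto simp: P_def less_Suc_eq_le simp del: upt_Suc)
  have P_snoc: "P q = filter (slot q) [0..<m] @ [m]" for q
    by (simp add: P_def slot_def)
  have P: "P q \<noteq> [] \<and> sorted_wrt (<) (P q) \<and> hd (P q) = z \<and> last (P q) = m" for q
  proof -
    have "hd (P q) = z"
    proof (cases "heads q = {}")
      case True
      then have "filter (slot q) [0..<m] = []" by (auto simp: slot_def filter_empty_conv)
      moreover have "z = m" using True by (auto simp: z_def heads_def)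
      ultimately show ?thesis by (simp add: P_snoc)
    next
      case False
      then have "slot q 0" "z = 0" by (auto simp: slot_def z_def heads_def)
      then show ?thesis unfolding P_def by (simp add: upt_conv_Cons del: upt_Suc)
    qed
    moreover have "sorted_wrt (<) (P q)" unfolding P_def by (intro sorted_wrt_filter sorted_wrt_upt)
    ultimately show ?thesis by (simp add: P_snoc)
  qed
  have f_ne: "f q \<noteq> []" for q using P[of q] by (simp add: f_def)
  have f_hd: "hd (f q) = ins z N q" and f_last: "last (f q) = ins m N q" for q
    using P[of q] by (simp_all add: f_def hd_map last_map)
  have set_ps: "set ps = {ins i N q | q i. q \<in> set qs \<and> i \<in> set (P q)}"
    by (auto simp: ps_def set_zigzag f_def)
  have "J_sequence (set ps) ps"
    unfolding ps_def f_def
  proof (rule J_sequence_zigzag[where z = z, OF J dist refl])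
    show "length q = m \<and> (\<forall>y\<in>set q. y < N)" if "q \<in> set qs" for q
      using chordal_extension_word.q_length[OF word[OF that]] qs[OF that] by auto
    show "z = 0 \<or> z = m" by (simp add: z_def)
    show "set (zigzag True (\<lambda>q. map (\<lambda>i. ins i N q) (P q)) qs) =
        {ins i N q |q i. q \<in> set qs \<and> i \<in> set (P q)}"
      using set_ps unfolding ps_def f_def .
  qed (use P in auto)
  moreover have "distinct ps"
    unfolding ps_def
  proof (rule distinct_zigzag[OF dist])
    have ins_eq: "ins i N p = ins j N q \<longleftrightarrow> i = j \<and> p = q"
      if "p \<in> set qs" "q \<in> set qs" "i \<in> set (P p)" "j \<in> set (P q)" for i j p q
      using that slot_le chordal_extension_word.q_length[OF word] chordal_extension_word.N_notin[OF word]
      by (intro ins_eq_iff) (auto simp: P_set)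
    show "distinct (f q)" if "q \<in> set qs" for q
      unfolding f_def distinct_map using ins_eq[OF that that] by (auto simp: P_def inj_on_def)
    show "set (f p) \<inter> set (f q) = {}" if "p \<in> set qs" "q \<in> set qs" "p \<noteq> q" for p q
      using ins_eq that by (auto simp: f_def)
  qed
  moreover have "hd ps = [1..<Suc N]"
  proof -
    obtain q qs' where "qs = q # qs'" using J unfolding J_sequence_def by (cases qs) auto
    then have "hd ps = ins m N [1..<N]" using f_ne[of q] f_last[of q] hd
      by (simp add: ps_def hd_rev)
    also have "\<dots> = [1..<N] @ [N]" using ins_length[of "[1..<N]" N] by (simp del: upt_Suc)
    also have "\<dots> = [1..<Suc N]" by simp
    finally show ?thesis .
  qed
  moreover have "distinct p \<and> set p = {1..N} \<and> perm_of N E (orient E p) = p" if p: "p \<in> set ps" for p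
  proof -
    obtain q i where qi: "q \<in> set qs" "slot q i" "p = ins i N q"
      using p unfolding set_ps P_set by auto
    interpret chordal_extension_word m E q using word[OF qi(1)] .
    show ?thesis using ins_word[of i] perm_of_orient_ins[OF qi(2)] qs[OF qi(1)] qi(3) by blast
  qed
  moreover have "orient E ` set ps = acyclic_orientations E"
  proof
    show "orient E ` set ps \<subseteq> acyclic_orientations E"
      using chordal_extension_word.orient_ins_acyclic[OF word] unfolding set_ps by auto
    show "acyclic_orientations E \<subseteq> orient E ` set ps"
    proof
      fix h assume h: "h \<in> acyclic_orientations E"
      have "restrict h E' \<in> acyclic_orientations E'"
        using h by (rule restrict_acyclic_orientations) (auto simp: edge'_iff)
      then obtain q where q: "q \<in> set qs" "restrict h E' = orient E' q" using AO by (metis imageE)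
      obtain k where "slot q k" "h = orient E (ins k N q)"
        using chordal_extension_word.orientation_extends[OF word[OF q(1)] h q(2)] .
      then show "h \<in> orient E ` set ps" using q(1) unfolding set_ps P_set by blast
    qed
  qed
  moreover have "successively (\<lambda>p p'. flip_adjacent N E (orient E p) (orient E p')) ps"
    unfolding ps_def
  proof (rule successively_zigzag[OF flips])
    fix q assume q: "q \<in> set qs"
    interpret chordal_extension_word m E q using word[OF q] .
    have "successively (\<lambda>i i'. flip_adjacent N E (orient E (ins i N q)) (orient E (ins i' N q))) (P q)"
    proof (rule successively_mono[OF successively_gapless])
      show "sorted_wrt (<) (P q)" using P by blast
      fix i i' assume "i \<in> set (P q)" "i' \<in> set (P q)"
        "i < i' \<and> (\<forall>k\<in>set (P q). \<not> (i < k \<and> k < i'))"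
      then show "flip_adjacent N E (orient E (ins i N q)) (orient E (ins i' N q))"
        unfolding P_set by (intro flip_consecutive_slots) auto
    qed
    then show "f q \<noteq> [] \<and> successively (\<lambda>p p'. flip_adjacent N E (orient E p) (orient E p')) (f q)"
      using f_ne by (simp add: f_def successively_map)
  next
    fix p q assume pq: "p \<in> set qs" "q \<in> set qs" "flip_adjacent m E' (orient E' p) (orient E' q)"
    have "z = 0 \<or> z = m" by (simp add: z_def)
    then show "flip_adjacent N E (orient E (hd (f p))) (orient E (hd (f q))) \<and>
        flip_adjacent N E (orient E (last (f p))) (orient E (last (f q)))"
      unfolding f_hd f_last using pq qs by (auto intro!: flip_adjacent_ins_end)
  next
    show "symp (\<lambda>p p'. flip_adjacent N E (orient E p) (orient E p'))"
      by (auto intro!: sympI flip_adjacent_sym)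
  qed
  ultimately show ?case by blast
qed

section \<open>Vertices and edges of the nestohedron\<close>

text \<open>The weight of a vertex counts its strict predecessors; along an arc the tail is counted
  for the head but, by acyclicity, not for itself.\<close>

lemma acyclic_weight:
  assumes "finite R" "acyclic R"
  obtains f :: "'a \<Rightarrow> nat" where "\<And>x y. (x, y) \<in> R \<Longrightarrow> f x < f y"
proof
  fix x y assume xy: "(x, y) \<in> R"
  have fin: "finite {z. (z, y) \<in> R\<^sup>+}"
    by (rule finite_subset[of _ "Domain R"]) (use assms(1) in \<open>auto simp: finite_Domain dest: tranclD\<close>)
  have "{z. (z, x) \<in> R\<^sup>+} \<subseteq> {z. (z, y) \<in> R\<^sup>+}"
    using xy by (auto intro: trancl_into_trancl)
  moreover have "x \<in> {z. (z, y) \<in> R\<^sup>+} - {z. (z, x) \<in> R\<^sup>+}"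
    using xy assms(2) by (auto simp: acyclic_def)
  ultimately show "card {z. (z, x) \<in> R\<^sup>+} < card {z. (z, y) \<in> R\<^sup>+}"
    by (intro psubset_card_mono[OF fin]) blast
qed

lemma arcs_finite: "hypergraph n E \<Longrightarrow> finite (arcs E h)"
  by (rule finite_subset[of _ "{1..n} \<times> {1..n}"]) (auto simp: arcs_def hypergraph_def)

lemma acyclic_orientation_weight:
  assumes "hypergraph n E" "h \<in> acyclic_orientations E"
  shows "\<exists>f :: nat \<Rightarrow> nat. \<forall>A\<in>E. \<forall>v\<in>A. v \<noteq> h A \<longrightarrow> f v < f (h A)"
proof -
  have "acyclic (arcs E h)" and hA: "\<And>A. A \<in> E \<Longrightarrow> h A \<in> A"
    using assms(2) by (auto simp: acyclic_orientations_def)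
  then obtain f :: "nat \<Rightarrow> nat" where "\<And>x y. (x, y) \<in> arcs E h \<Longrightarrow> f x < f y"
    using acyclic_weight[OF arcs_finite[OF assms(1)]] by metis
  then show ?thesis using hA by (intro exI[of _ f]) (auto simp: arcs_def)
qed

text \<open>These weights give the functional that exposes the edge of a flip: the only tie a
  hyperedge can have at its maximum is between \<open>i\<close> and \<open>j\<close>.\<close>

lemma flip_weight:
  assumes E: "hypergraph n E" and h: "h \<in> acyclic_orientations E" "h' \<in> acyclic_orientations E"
    and flip: "h' = pair_flip E i j h" "h' \<noteq> h" and ij: "i \<noteq> j"
  shows "\<exists>w :: nat \<Rightarrow> nat. w i = w j \<and>
    (\<forall>A\<in>E. \<forall>v\<in>A. v \<noteq> h A \<longrightarrow> \<not> (v = i \<and> h A = j) \<longrightarrow> w v < w (h A))"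
proof -
  let ?H = "arcs E h" and ?H' = "arcs E h'"
  have hA: "h A \<in> A" if "A \<in> E" for A using h that by (auto simp: acyclic_orientations_def)
  have ext: "h A = undefined" if "A \<notin> E" for A
    using h(1) that PiE_arb[of h E "\<lambda>A. A" A] by (simp add: acyclic_orientations_def)
  have h': "h' A = (if h A = j \<and> i \<in> A then i else h A)" if "A \<in> E" for A
    using that by (simp add: flip(1) pair_flip_def)
  have acyc: "(x, x) \<notin> ?H\<^sup>+" "(x, x) \<notin> ?H'\<^sup>+" for x
    using h by (auto simp: acyclic_orientations_def acyclic_def)
  obtain A0 where A0: "A0 \<in> E" "h A0 = j" "i \<in> A0"
  proof -
    obtain A where A: "h' A \<noteq> h A" using flip(2) by blast
    then have "A \<in> E" using ext[of A] by (auto simp: flip(1) pair_flip_def split: if_splits)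
    then show ?thesis using A that[of A] h'[of A] by (auto split: if_splits)
  qed
  have ijH: "(i, j) \<in> ?H" using A0 hA[OF A0(1)] ij by (auto simp: arcs_def)
  have jiH': "(j, i) \<in> ?H'" using A0 hA[OF A0(1)] ij h'[OF A0(1)] by (auto simp: arcs_def)
  \<comment> \<open>Only arcs into \<open>j\<close> are affected by the flip, so a path from
    \<open>i\<close> that stays below \<open>j\<close> survives it.\<close>
  have arc': "(x, y) \<in> ?H'" if "(x, y) \<in> ?H" "y \<noteq> j" for x y
    using that h' by (auto simp: arcs_def)
  have path': "(i, y) \<in> ?H\<^sup>+ \<Longrightarrow> (y, j) \<in> ?H\<^sup>+ \<Longrightarrow> (i, y) \<in> ?H'\<^sup>+" for y
  proof (induction rule: trancl_induct)
    case (base y)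
    then have "y \<noteq> j" using acyc by blast
    then show ?case using arc' base by blast
  next
    case (step y z)
    then have "z \<noteq> j" "(y, j) \<in> ?H\<^sup>+" using acyc by (blast, meson trancl_into_trancl2)
    then show ?case using arc' step by (meson trancl_into_trancl)
  qed
  \<comment> \<open>A directed path from \<open>i\<close> to \<open>j\<close> through a third vertex would be closed to a cycle by the flip, so
    \<open>i\<close> and \<open>j\<close> may get the same weight.\<close>
  have gap: False if x: "(i, x) \<in> ?H\<^sup>+" "(x, j) \<in> ?H" for x
  proof -
    obtain B where B: "B \<in> E" "h B = j" "x \<in> B" "x \<noteq> j" using x(2) by (auto simp: arcs_def)
    have ix: "(i, x) \<in> ?H'\<^sup>+" using path' x by blast
    then have "x \<noteq> i" using acyc by blast
    show False
    proof (cases "i \<in> B")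
      case True
      then have "(x, i) \<in> ?H'" using B h'[OF B(1)] \<open>x \<noteq> i\<close> by (auto simp: arcs_def)
      then show False using ix acyc by (meson trancl_into_trancl)
    next
      case False
      then have "h' B = j" using B(2) h'[OF B(1)] by simp
      then have "(x, j) \<in> ?H'" using arcsI[of B E x h'] B hA[OF B(1)] by simp
      then show False using ix jiH' acyc by (meson trancl_into_trancl)
    qed
  qed
  obtain f :: "nat \<Rightarrow> nat" where f: "\<forall>A\<in>E. \<forall>v\<in>A. v \<noteq> h A \<longrightarrow> f v < f (h A)"
    using acyclic_orientation_weight[OF E h(1)] by blast
  define K where "K = Suc (Max (f ` {1..n}))"
  define U where "U = {v. v \<noteq> j \<and> (i, v) \<in> ?H\<^sup>+}"
  \<comment> \<open>\<open>K\<close> exceeds all values of \<open>f\<close> on vertices: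
    \<open>i\<close> and \<open>j\<close> share level \<open>K\<close>, everything else reachable
    from \<open>i\<close> is lifted above it, and the rest keeps \<open>f\<close>. Apart from arcs
    from \<open>i\<close> to \<open>j\<close>, every arc out of \<open>i\<close>, \<open>j\<close>
    or \<open>U\<close> ends in \<open>U\<close>, so weights increase along it.\<close>
  define w where "w = (\<lambda>v. if v = i \<or> v = j then K else if v \<in> U then K + Suc (f v) else f v)"
  have f_less: "f v < K" if "A \<in> E" "v \<in> A" for A v
  proof -
    have "v \<in> {1..n}" using E that unfolding hypergraph_def by blast
    then show ?thesis unfolding K_def by (simp add: less_Suc_eq_le)
  qed
  have "i \<notin> U" "j \<notin> U" using acyc by (auto simp: U_def)
  show ?thesis
  proof (intro exI[of _ w] conjI ballI impI)
    show "w i = w j" by (simp add: w_def)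
    fix A v assume A: "A \<in> E" "v \<in> A" "v \<noteq> h A" and not: "\<not> (v = i \<and> h A = j)"
    have arc: "(v, h A) \<in> ?H" using A hA[OF A(1)] by (auto simp: arcs_def)
    have no_back: "\<not> (v = j \<and> h A = i)" using arc ijH acyc by (meson r_into_trancl' trancl_into_trancl)
    have "f v < f (h A)" using f A by blast
    consider "v = i \<or> v = j" | "v \<in> U" | "v \<notin> U" "v \<noteq> i" "v \<noteq> j" by blast
    then show "w v < w (h A)"
    proof cases
      case 1
      then have "h A \<noteq> i" "h A \<noteq> j" using A(3) not no_back by auto
      moreover have "(i, h A) \<in> ?H\<^sup>+" using 1 arc ijH by (meson r_into_trancl' trancl_into_trancl)
      ultimately show ?thesis using 1 by (auto simp: w_def U_def)
    next
      case 2
      then have "(i, h A) \<in> ?H\<^sup>+" using arc by (auto simp: U_def intro: trancl_into_trancl)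
      moreover from this have "h A \<noteq> i" using acyc by auto
      moreover have "h A \<noteq> j" using gap[of v] 2 arc by (auto simp: U_def)
      ultimately show ?thesis
        using 2 \<open>f v < f (h A)\<close> \<open>i \<notin> U\<close> \<open>j \<notin> U\<close> by (auto simp: w_def U_def)
    next
      case 3
      then show ?thesis using \<open>f v < f (h A)\<close> f_less[OF A(1,2)] by (auto simp: w_def)
    qed
  qed
qed

section \<open>The nestohedron, its vertices, and the edges coming from flips\<close>

locale labelled_hypergraph =
  fixes n :: nat and E :: "nat set set" and lab :: "'d::finite \<Rightarrow> nat"
  assumes hypergraph: "hypergraph n E" and lab: "bij_betw lab UNIV {1..n}"
begin

abbreviation "\<delta> \<equiv> indegrees lab E"

definition unit_vec :: "nat \<Rightarrow> real ^ 'd" where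
  "unit_vec v = (\<chi> k. of_bool (lab k = v))"

definition weight :: "(nat \<Rightarrow> real) \<Rightarrow> real ^ 'd" where
  "weight w = (\<chi> k. w (lab k))"

lemma edge: "A \<in> E \<Longrightarrow> A \<subseteq> {1..n}" "finite E"
  using hypergraph finite_subset[of E "Pow {1..n}"] by (auto simp: hypergraph_def)

lemma obtain_lab:
  assumes "v \<in> {1..n}"
  obtains k where "lab k = v"
  using assms lab by (metis bij_betw_def imageE)

lemma lab_eq_iff: "lab k = lab l \<longleftrightarrow> k = l"
  using lab by (auto simp: bij_betw_def inj_on_def)

lemma unit_vec_lab: "unit_vec (lab k) = axis k 1"
  by (simp add: unit_vec_def axis_def lab_eq_iff vec_eq_iff)

lemma unit_vec_eq_iff: "v \<in> {1..n} \<Longrightarrow> unit_vec u = unit_vec v \<longleftrightarrow> u = v"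
  using obtain_lab[of v] by (auto simp: unit_vec_def vec_eq_iff)

lemma weight_unit_vec:
  assumes "v \<in> {1..n}"
  shows "weight w \<bullet> unit_vec v = w v"
proof -
  obtain k where "lab k = v" using obtain_lab[OF assms] .
  then show ?thesis using unit_vec_lab[of k] by (auto simp: inner_axis weight_def)
qed

lemma indegrees_eq: "\<delta> h = (\<Sum>A\<in>E. unit_vec (h A))"
proof -
  have "(\<Sum>A\<in>E. of_bool (lab k = h A)) = real (card {A \<in> E. h A = lab k})" for k
    using edge(2) by (simp add: sum_of_bool_eq Collect_conj_eq eq_commute Int_commute)
  then show ?thesis by (simp add: indegrees_def vec_eq_iff unit_vec_def)
qed

lemma weight_indegrees:
  assumes "\<And>A. A \<in> E \<Longrightarrow> h A \<in> A"
  shows "weight w \<bullet> \<delta> h = (\<Sum>A\<in>E. w (h A))"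
  unfolding indegrees_eq inner_sum_right
  using assms edge(1) by (intro sum.cong refl weight_unit_vec) blast

text \<open>Cyclic orientations are included, as they too are choices of one corner per simplex in
  the Minkowski sum.\<close>

definition points :: "(real ^ 'd) set" where
  "points = \<delta> ` (\<Pi>\<^sub>E A\<in>E. A)"

lemma finite_points: "finite points"
  unfolding points_def
proof (intro finite_imageI finite_PiE)
  show "finite A" if "A \<in> E" for A using edge(1)[OF that] by (rule finite_subset) simp
qed (rule edge(2))

text \<open>Convex hulls commute with Minkowski sums, and choosing a corner of every simplex is
  choosing an orientation.\<close>

lemma nestohedron_eq: "nestohedron lab E = convex hull points"
proof -
  have simplex: "edge_simplex lab A = convex hull (unit_vec ` A)" if A: "A \<in> E" for A
  proof -
    have "unit_vec ` A = {axis k 1 | k. lab k \<in> A}"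
    proof (intro equalityI subsetI)
      fix x assume "x \<in> unit_vec ` A"
      then obtain v where v: "v \<in> A" "x = unit_vec v" by auto
      moreover obtain k where "lab k = v" using obtain_lab[of v] edge(1)[OF A] v by blast
      ultimately show "x \<in> {axis k 1 | k. lab k \<in> A}" using unit_vec_lab[of k] by auto
    next
      fix x assume "x \<in> {axis k (1::real) | k. lab k \<in> A}"
      then obtain k where "x = unit_vec (lab k)" "lab k \<in> A" using unit_vec_lab by auto
      then show "x \<in> unit_vec ` A" by blast
    qed
    then show ?thesis by (simp add: edge_simplex_def)
  qed
  have "nestohedron lab E = (\<Sum>A\<in>E. convex hull (unit_vec ` A))"
    unfolding nestohedron_def by (intro sum.cong refl simplex)
  also have "\<dots> = convex hull (\<Sum>A\<in>E. unit_vec ` A)" by (simp add: convex_hull_set_sum)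
  also have "(\<Sum>A\<in>E. unit_vec ` A) = points"
  proof (intro equalityI subsetI)
    fix x assume "x \<in> (\<Sum>A\<in>E. unit_vec ` A)"
    then obtain s where s: "x = sum s E" "\<forall>A\<in>E. s A \<in> unit_vec ` A"
      unfolding set_sum_alt[OF edge(2)] by auto
    then have "\<forall>A\<in>E. \<exists>v. v \<in> A \<and> s A = unit_vec v" by blast
    then obtain g where g: "\<And>A. A \<in> E \<Longrightarrow> g A \<in> A \<and> s A = unit_vec (g A)" by metis
    then have "x = \<delta> (restrict g E)" unfolding s(1) indegrees_eq by (intro sum.cong) auto
    moreover have "restrict g E \<in> (\<Pi>\<^sub>E A\<in>E. A)" using g by auto
    ultimately show "x \<in> points" unfolding points_def by blast
  next
    fix x assume "x \<in> points"
    then obtain g where "g \<in> (\<Pi>\<^sub>E A\<in>E. A)" "x = \<delta> g" by (auto simp: points_def)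
    then show "x \<in> (\<Sum>A\<in>E. unit_vec ` A)"
      unfolding set_sum_alt[OF edge(2)] indegrees_eq by (auto intro!: exI[of _ "\<lambda>A. unit_vec (g A)"])
  qed
  finally show ?thesis .
qed

text \<open>Arguing with the finitely many points of all orientations instead of the whole Minkowski sum is enough,
  since a face of a polytope is the convex hull of some of its generating points.\<close>

lemma maximal_face:
  fixes w :: "nat \<Rightarrow> nat"
  assumes h: "h \<in> (\<Pi>\<^sub>E A\<in>E. A)" and max: "\<And>A v. A \<in> E \<Longrightarrow> v \<in> A \<Longrightarrow> w v \<le> w (h A)"
  shows "\<exists>T. T face_of nestohedron lab E \<and>
    (\<forall>g\<in>(\<Pi>\<^sub>E A\<in>E. A). \<delta> g \<in> T \<longleftrightarrow> (\<forall>A\<in>E. w (g A) = w (h A))) \<and>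
    T \<subseteq> convex hull (points \<inter> T)"
proof -
  let ?a = "weight (\<lambda>v. real (w v))"
  define T where "T = nestohedron lab E \<inter> {x. ?a \<bullet> x = ?a \<bullet> \<delta> h}"
  have wsum: "?a \<bullet> \<delta> g = (\<Sum>A\<in>E. real (w (g A)))" if "g \<in> (\<Pi>\<^sub>E A\<in>E. A)" for g
    using that by (intro weight_indegrees) auto
  have le: "?a \<bullet> \<delta> g \<le> ?a \<bullet> \<delta> h" if "g \<in> (\<Pi>\<^sub>E A\<in>E. A)" for g
    unfolding wsum[OF that] wsum[OF h] using max that by (intro sum_mono) (auto simp: PiE_iff)
  have "points \<subseteq> {x. ?a \<bullet> x \<le> ?a \<bullet> \<delta> h}" using le by (auto simp: points_def)
  then have "nestohedron lab E \<subseteq> {x. ?a \<bullet> x \<le> ?a \<bullet> \<delta> h}"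
    unfolding nestohedron_eq by (intro hull_minimal convex_halfspace_le)
  then have face: "T face_of nestohedron lab E"
    unfolding T_def by (intro face_of_Int_supporting_hyperplane_le) (auto simp: nestohedron_eq)
  moreover have "\<delta> g \<in> T \<longleftrightarrow> (\<forall>A\<in>E. w (g A) = w (h A))" if g: "g \<in> (\<Pi>\<^sub>E A\<in>E. A)" for g
  proof -
    have "\<delta> g \<in> nestohedron lab E" unfolding nestohedron_eq using g by (auto simp: points_def intro: hull_inc)
    then have "\<delta> g \<in> T \<longleftrightarrow> (\<Sum>A\<in>E. real (w (g A))) = (\<Sum>A\<in>E. real (w (h A)))"
      unfolding T_def using wsum[OF g] wsum[OF h] by simp
    also have "\<dots> \<longleftrightarrow> (\<forall>A\<in>E. w (g A) = w (h A))"
    proof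
      assume eq: "(\<Sum>A\<in>E. real (w (g A))) = (\<Sum>A\<in>E. real (w (h A)))"
      \<comment> \<open>The inequality holds hyperedge by hyperedge, so equality of the sums forces
        equality of all terms.\<close>
      have "real (w (g A)) = real (w (h A))" if "A \<in> E" for A
        by (rule sum_mono_inv[OF eq _ that edge(2)]) (use max g in \<open>auto simp: PiE_iff\<close>)
      then show "\<forall>A\<in>E. w (g A) = w (h A)" by simp
    qed auto
    finally show ?thesis .
  qed
  moreover have "T \<subseteq> convex hull (points \<inter> T)"
  proof -
    obtain S where S: "S \<subseteq> points" "T = convex hull S"
      using face_of_convex_hull_subset[OF finite_imp_compact[OF finite_points]] face
      unfolding nestohedron_eq by metis
    then have "S \<subseteq> points \<inter> T" using hull_subset[of S convex] by auto
    then show ?thesis using S(2) hull_mono by metis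
  qed
  ultimately show ?thesis by blast
qed

text \<open>With weights increasing along the arcs, \<open>h A\<close> is the only maximum of each
  \<open>A\<close>. So the maximal face is a single point, and no other orientation, acyclic or not,
  has the same indegrees.\<close>

lemma acyclic_orientation_vertex:
  assumes "h \<in> acyclic_orientations E"
  shows "\<delta> h extreme_point_of nestohedron lab E"
    and "g \<in> (\<Pi>\<^sub>E A\<in>E. A) \<Longrightarrow> \<delta> g = \<delta> h \<Longrightarrow> g = h"
proof -
  have h: "h \<in> (\<Pi>\<^sub>E A\<in>E. A)" using assms by (simp add: acyclic_orientations_def)
  obtain f :: "nat \<Rightarrow> nat" where f: "\<forall>A\<in>E. \<forall>v\<in>A. v \<noteq> h A \<longrightarrow> f v < f (h A)"
    using acyclic_orientation_weight[OF hypergraph assms] by blast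
  then have le: "f v \<le> f (h A)" if "A \<in> E" "v \<in> A" for A v
    using that by (cases "v = h A") (auto intro: less_imp_le)
  obtain T where T: "T face_of nestohedron lab E"
    "\<forall>g\<in>(\<Pi>\<^sub>E A\<in>E. A). \<delta> g \<in> T \<longleftrightarrow> (\<forall>A\<in>E. f (g A) = f (h A))"
    "T \<subseteq> convex hull (points \<inter> T)"
    using maximal_face[of h f, OF h le] by blast
  have unique: "g = h" if g: "g \<in> (\<Pi>\<^sub>E A\<in>E. A)" "\<delta> g \<in> T" for g
  proof (rule PiE_ext[OF g(1) h])
    fix A assume A: "A \<in> E"
    then have "f (g A) = f (h A)" "g A \<in> A" using bspec[OF T(2) g(1)] g by auto
    then show "g A = h A" using f A by (metis less_irrefl)
  qed
  have hT: "\<delta> h \<in> T" using bspec[OF T(2) h] by simp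
  then have "points \<inter> T \<subseteq> {\<delta> h}" using unique by (auto simp: points_def)
  then have "T = {\<delta> h}" using T(3) hT hull_mono[of "points \<inter> T" "{\<delta> h}" convex] by auto
  then show "\<delta> h extreme_point_of nestohedron lab E"
    using T(1) by (simp add: face_of_singleton)
  show "g = h" if "g \<in> (\<Pi>\<^sub>E A\<in>E. A)" "\<delta> g = \<delta> h"
    by (rule unique[OF that(1)]) (simp only: that(2) hT)
qed

lemma indegrees_inj: "inj_on \<delta> (acyclic_orientations E)"
  using acyclic_orientation_vertex(2) by (auto simp: inj_on_def acyclic_orientations_def)

text \<open>A vertex of a polyhedron is exposed by a linear functional. Its values on the unit
  vectors increase along all arcs, because redirecting a single hyperedge leaves the vertex and must
  lower the functional.\<close>

lemma vertex_acyclic_orientation: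
  assumes x: "x extreme_point_of nestohedron lab E"
  obtains h where "h \<in> acyclic_orientations E" "x = \<delta> h"
proof -
  have "x \<in> points" using x unfolding nestohedron_eq by (rule extreme_point_of_convex_hull)
  then obtain g where g: "g \<in> (\<Pi>\<^sub>E A\<in>E. A)" "x = \<delta> g" by (auto simp: points_def)
  have "polyhedron (nestohedron lab E)"
    unfolding nestohedron_eq using finite_points by (simp add: polyhedron_convex_hull)
  moreover have "{x} face_of nestohedron lab E" using x by (simp add: face_of_singleton)
  ultimately have "{x} exposed_face_of nestohedron lab E"
    using exposed_face_of_polyhedron by blast
  then obtain a b where ab: "nestohedron lab E \<subseteq> {y. a \<bullet> y \<le> b}"
    "{x} = nestohedron lab E \<inter> {y. a \<bullet> y = b}"
    unfolding exposed_face_of_def by blast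
  define w where "w v = a \<bullet> unit_vec v" for v
  have less: "w u < w (g A)" if A: "A \<in> E" "u \<in> A" "u \<noteq> g A" for A u
  proof -
    let ?g = "g(A := u)"
    have "?g \<in> (\<Pi>\<^sub>E A\<in>E. A)" using g(1) A by (auto simp: PiE_iff extensional_def)
    then have in_Z: "\<delta> ?g \<in> nestohedron lab E"
      unfolding nestohedron_eq by (auto simp: points_def intro: hull_inc)
    have "(\<Sum>B\<in>E - {A}. unit_vec (?g B)) = (\<Sum>B\<in>E - {A}. unit_vec (g B))" by (intro sum.cong) auto
    then have diff: "\<delta> ?g = x + unit_vec u - unit_vec (g A)"
      unfolding g(2) indegrees_eq using sum.remove[OF edge(2) A(1), of "\<lambda>B. unit_vec (?g B)"]
        sum.remove[OF edge(2) A(1), of "\<lambda>B. unit_vec (g B)"] by simp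
    have "a \<bullet> x = b" using ab(2) by auto
    then have val: "a \<bullet> \<delta> ?g = b + w u - w (g A)"
      unfolding diff by (simp add: inner_simps w_def)
    \<comment> \<open>Equality would put the moved point on the exposed face \<open>{x}\<close>,
      although it differs from \<open>x\<close>.\<close>
    have "w u \<noteq> w (g A)"
    proof
      assume "w u = w (g A)"
      then have "\<delta> ?g = x" using in_Z val ab(2) by auto
      then have "unit_vec (g A) = unit_vec u" using diff by (simp add: algebra_simps)
      then show False using unit_vec_eq_iff[of u "g A"] edge(1)[OF A(1)] A(2,3) by auto
    qed
    moreover have "w u \<le> w (g A)" using in_Z ab(1) val by auto
    ultimately show ?thesis by simp
  qed
  have "arcs E g \<subseteq> {(u, v). w u < w v}" using less by (auto simp: arcs_def)
  then have "(arcs E g)\<^sup>+ \<subseteq> {(u, v). w u < w v}\<^sup>+" by (rule trancl_mono_subset)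
  also have "\<dots> = {(u, v). w u < w v}" by (intro trancl_id transI) auto
  finally have "acyclic (arcs E g)" by (auto simp: acyclic_def)
  then show thesis using that[of g] g by (simp add: acyclic_orientations_def)
qed

lemma vertices: "{x. x extreme_point_of nestohedron lab E} = \<delta> ` acyclic_orientations E"
  using acyclic_orientation_vertex(1) vertex_acyclic_orientation by blast

text \<open>Under the weights of \<open>flip_weight\<close>, orientations on the maximal face differ
  from \<open>h\<close> only by moving hyperedges from \<open>j\<close> to \<open>i\<close>, and
  each move shifts the point by the same vector \<open>e\<close>. So the face lies on a line, with
  \<open>h'\<close> at the far end as it makes every possible move.\<close>

lemma pair_flip_edge:
  assumes h: "h \<in> acyclic_orientations E" "h' \<in> acyclic_orientations E"
    and flip: "h' = pair_flip E i j h" "h' \<noteq> h" and ij: "i \<noteq> j"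
  shows "closed_segment (\<delta> h) (\<delta> h') edge_of nestohedron lab E"
proof -
  have hPi: "h \<in> (\<Pi>\<^sub>E A\<in>E. A)" "h' \<in> (\<Pi>\<^sub>E A\<in>E. A)"
    using h by (auto simp: acyclic_orientations_def)
  obtain w :: "nat \<Rightarrow> nat" where w: "w i = w j"
    "\<forall>A\<in>E. \<forall>v\<in>A. v \<noteq> h A \<longrightarrow> \<not> (v = i \<and> h A = j) \<longrightarrow> w v < w (h A)"
    using flip_weight[OF hypergraph h flip ij] by blast
  have le: "w v \<le> w (h A)" if "A \<in> E" "v \<in> A" for A v
    using w that by (metis less_imp_le order_refl)
  obtain T where T: "T face_of nestohedron lab E"
    "\<forall>g\<in>(\<Pi>\<^sub>E A\<in>E. A). \<delta> g \<in> T \<longleftrightarrow> (\<forall>A\<in>E. w (g A) = w (h A))"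
    "T \<subseteq> convex hull (points \<inter> T)"
    using maximal_face[of h w, OF hPi(1) le] by blast
  have h': "h' A = (if h A = j \<and> i \<in> A then i else h A)" if "A \<in> E" for A
    using that by (simp add: flip(1) pair_flip_def)
  define e where "e = unit_vec i - unit_vec j"
  have moved: "\<delta> g = \<delta> h + real (card {A \<in> E. g A \<noteq> h A}) *\<^sub>R e"
    if "\<And>A. A \<in> E \<Longrightarrow> g A \<noteq> h A \<Longrightarrow> g A = i \<and> h A = j" for g
  proof -
    have "\<delta> g = (\<Sum>A\<in>E. unit_vec (h A) + (if g A \<noteq> h A then e else 0))"
      unfolding indegrees_eq using that by (intro sum.cong) (auto simp: e_def)
    also have "\<dots> = \<delta> h + (\<Sum>A\<in>{A \<in> E. g A \<noteq> h A}. e)"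
      unfolding sum.distrib indegrees_eq by (subst sum.inter_filter[OF edge(2)]) simp
    finally show ?thesis by (simp add: scaleR_conv_of_real sum_constant_scaleR)
  qed
  define F where "F = {A \<in> E. h' A \<noteq> h A}"
  have finF: "finite F" using edge(2) by (simp add: F_def)
  have \<delta>h': "\<delta> h' = \<delta> h + real (card F) *\<^sub>R e"
    unfolding F_def by (rule moved) (auto simp: h' split: if_splits)
  have "F \<noteq> {}" using flip(2) PiE_ext[OF hPi(2,1)] by (auto simp: F_def)
  then have F_pos: "card F > 0" using finF by (simp add: card_gt_0_iff)
  have "points \<inter> T \<subseteq> closed_segment (\<delta> h) (\<delta> h')"
  proof
    fix x assume "x \<in> points \<inter> T"
    then obtain g where g: "g \<in> (\<Pi>\<^sub>E A\<in>E. A)" "x = \<delta> g" "\<forall>A\<in>E. w (g A) = w (h A)"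
      using T(2) by (auto simp: points_def)
    have gh: "g A = i \<and> h A = j" if A: "A \<in> E" "g A \<noteq> h A" for A
      using w(2) g A by (metis PiE_mem less_irrefl)
    have "{A \<in> E. g A \<noteq> h A} \<subseteq> F"
    proof
      fix A assume "A \<in> {A \<in> E. g A \<noteq> h A}"
      then have A: "A \<in> E" "g A = i" "h A = j" "i \<in> A" using gh[of A] g(1) by (auto simp: PiE_iff)
      then show "A \<in> F" using h'[OF A(1)] ij by (simp add: F_def)
    qed
    then have le: "card {A \<in> E. g A \<noteq> h A} \<le> card F" by (rule card_mono[OF finF])
    \<comment> \<open>The fraction of the hyperedges in \<open>F\<close> that \<open>g\<close> moves
      is the parameter of its point on the segment.\<close>
    define u where "u = real (card {A \<in> E. g A \<noteq> h A}) / real (card F)"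
    have "u * real (card F) = real (card {A \<in> E. g A \<noteq> h A})" using F_pos by (simp add: u_def)
    then have "x = (1 - u) *\<^sub>R \<delta> h + u *\<^sub>R \<delta> h'"
      using moved[OF gh] unfolding g(2) \<delta>h' by (simp add: algebra_simps)
    moreover have "0 \<le> u" "u \<le> 1" using le F_pos by (auto simp: u_def divide_simps)
    ultimately show "x \<in> closed_segment (\<delta> h) (\<delta> h')" by (auto simp: closed_segment_def)
  qed
  then have "T \<subseteq> closed_segment (\<delta> h) (\<delta> h')"
    using T(3) hull_minimal[of "points \<inter> T" _ convex] by (meson convex_closed_segment order_trans)
  moreover have "closed_segment (\<delta> h) (\<delta> h') \<subseteq> T"
  proof (rule closed_segment_subset)
    show "\<delta> h \<in> T" using bspec[OF T(2) hPi(1)] by simp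
    show "\<delta> h' \<in> T" using bspec[OF T(2) hPi(2)] h' w(1) by auto
    show "convex T" using T(1) by (rule face_of_imp_convex)
  qed
  ultimately have "closed_segment (\<delta> h) (\<delta> h') face_of nestohedron lab E" using T(1) by auto
  moreover have "\<delta> h \<noteq> \<delta> h'" using indegrees_inj h flip(2) by (auto simp: inj_on_def)
  then have "aff_dim (closed_segment (\<delta> h) (\<delta> h')) = 1"
    by (simp add: segment_convex_hull aff_dim_convex_hull)
  ultimately show ?thesis by (simp add: edge_of_def)
qed

lemma hamilton_path_skeleton:
  assumes "hamilton_path (flip_graph n E) hs"
  shows "hamilton_path (skeleton (nestohedron lab E)) (map \<delta> hs)"
proof -
  have hs: "distinct hs" "set hs = acyclic_orientations E"
    and step: "\<And>k. Suc k < length hs \<Longrightarrow> {hs ! k, hs ! Suc k} \<in> snd (flip_graph n E)"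
    using assms by (auto simp: hamilton_path_def flip_graph_def)
  have "{\<delta> (hs ! k), \<delta> (hs ! Suc k)} \<in> snd (skeleton (nestohedron lab E))"
    if k: "Suc k < length hs" for k
  proof -
    obtain h h' i j where h: "{hs ! k, hs ! Suc k} = {h, h'}" "h \<in> acyclic_orientations E"
      "h' \<in> acyclic_orientations E" "h' \<noteq> h" "i \<noteq> j" "h' = pair_flip E i j h"
      using step[OF k] unfolding flip_graph_def snd_conv by blast
    have "closed_segment (\<delta> h) (\<delta> h') edge_of nestohedron lab E"
      using pair_flip_edge h by blast
    moreover have "{\<delta> (hs ! k), \<delta> (hs ! Suc k)} = {\<delta> h, \<delta> h'}"
      using arg_cong[OF h(1), of "image \<delta>"] by simp
    ultimately show ?thesis unfolding skeleton_def snd_conv by blast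
  qed
  then show ?thesis
    using hs indegrees_inj vertices by (simp add: hamilton_path_def distinct_map skeleton_def)
qed

end

section \<open>Algorithm J on chordal building sets\<close>

theorem theorem18:
  fixes n :: nat and E :: "nat set set"
  assumes "chordal_building_set n E"
  shows "\<exists>hs. algorithm_J (perm_of n E ` acyclic_orientations E) [1..<Suc n]
                = Some (map (perm_of n E) hs) \<and>
              hamilton_path (flip_graph n E) hs \<and>
              (\<forall>lab :: 'd::finite \<Rightarrow> nat. bij_betw lab UNIV {1..n} \<longrightarrow>
                 hamilton_path (skeleton (nestohedron lab E)) (map (indegrees lab E) hs))"
proof -
  obtain ps where J: "J_sequence (set ps) ps" and ps: "distinct ps" "hd ps = [1..<Suc n]"
    and inv: "\<forall>p\<in>set ps. perm_of n E (orient E p) = p"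
    and AO: "orient E ` set ps = acyclic_orientations E"
    and flips: "successively (\<lambda>p p'. flip_adjacent n E (orient E p) (orient E p')) ps"
    using chordal_sequence[OF assms] by blast
  define hs where "hs = map (orient E) ps"
  have "map (perm_of n E) hs = ps" using inv by (simp add: hs_def map_idI)
  moreover have "perm_of n E ` acyclic_orientations E = set ps"
    using inv by (simp add: AO[symmetric] image_image)
  ultimately have run: "algorithm_J (perm_of n E ` acyclic_orientations E) [1..<Suc n]
      = Some (map (perm_of n E) hs)"
    using algorithm_J_eq[OF J] ps(2) by simp
  \<comment> \<open>\<open>perm_of\<close> is a left inverse of \<open>orient\<close> on the visited
    words, so distinct words give distinct orientations.\<close>
  have "inj_on (orient E) (set ps)" using inv by (metis inj_on_inverseI)
  then have hs: "distinct hs" "set hs = acyclic_orientations E"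
    using ps(1) AO by (simp_all add: hs_def distinct_map)
  have edge: "{h, h'} \<in> snd (flip_graph n E)"
    if "h \<in> acyclic_orientations E" "h' \<in> acyclic_orientations E" "h' \<noteq> h"
      "i \<in> {1..n}" "j \<in> {1..n}" "i \<noteq> j" "h' = pair_flip E i j h" for h h' i j
    using that unfolding flip_graph_def snd_conv by blast
  have "{hs ! k, hs ! Suc k} \<in> snd (flip_graph n E)" if k: "Suc k < length hs" for k
  proof -
    let ?h = "hs ! k" and ?h' = "hs ! Suc k"
    have "flip_adjacent n E ?h ?h'"
      using flips k by (simp add: successively_conv_nth hs_def)
    then obtain i j where ij: "i \<in> {1..n}" "j \<in> {1..n}" "i \<noteq> j" and ne: "?h' \<noteq> ?h"
      and flip: "?h' = pair_flip E i j ?h \<or> ?h = pair_flip E i j ?h'"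
      unfolding flip_adjacent_def by blast
    have h: "?h \<in> acyclic_orientations E" "?h' \<in> acyclic_orientations E"
      using k nth_mem[of k hs] nth_mem[of "Suc k" hs] by (simp_all add: hs(2))
    from flip show ?thesis
    proof
      assume "?h' = pair_flip E i j ?h"
      then show ?thesis by (rule edge[OF h ne ij])
    next
      assume "?h = pair_flip E i j ?h'"
      \<comment> \<open>Edges of the flip graph are unordered, so a flip in the reverse direction
        serves as well.\<close>
      then have "{?h', ?h} \<in> snd (flip_graph n E)" by (rule edge[OF h(2,1) ne[symmetric] ij])
      then show ?thesis by (simp add: insert_commute)
    qed
  qed
  then have path: "hamilton_path (flip_graph n E) hs"
    using hs by (simp add: hamilton_path_def flip_graph_def)
  have "hamilton_path (skeleton (nestohedron lab E)) (map (indegrees lab E) hs)"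
    if "bij_betw lab UNIV {1..n}" for lab :: "'d \<Rightarrow> nat"
  proof -
    interpret labelled_hypergraph n E lab
      using assms that by unfold_locales (auto simp: chordal_building_set_def building_set_def)
    show ?thesis using path by (rule hamilton_path_skeleton)
  qed
  then show ?thesis using run path by blast
qed

end
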